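(* Let $\omega\subset\mathbb R^{N-1}$, $N\ge2$, be a smooth bounded domain and let $f\in C^{1,\alpha}(\mathbb R)$, $\alpha\in(0,1)$, satisfy: $f'(s)>f(s)/s$ for all $s\neq 0$; $s f(s)>0$ for all $s\ne 0$; and the problem $$-\Delta u=f(u)\ \text{in }\Omega_\omega,\qquad u=0\ \text{on }\Gamma_0,\qquad \frac{\partial u}{\partial\nu}=0\ \text{on }\Gamma$$ has a solution. Let $u_\omega\not\equiv0$ be a one-dimensional solution of this problem. Then $u_\omega$ is nondegenerate in $H^1_{0,x_N}(\Omega_\omega\cup\Gamma)$.
   Context: Points of $\mathbb R^N$ are written $x=(x',x_N)$, $x'\in\mathbb R^{N-1}$. $\Omega_\omega=\omega\times(0,1)$, $\Gamma_0=\omega\times\{1\}$, $\Gamma=\partial\Omega_\omega\setminus\overline{\Gamma_0}$, $\nu$ is the outer unit normal. $H_0^1(\Omega_\omega\cup\Gamma)$ is the subspace of $H^1(\Omega_\omega)$ of functions with zero trace on $\Gamma_0$; solutions are weak solutions in this space. $H^1_{0,x_N}(\Omega_\omega\cup\Gamma)$ is its subspace of functions depending only on $x_N$. A one-dimensional solution is one of the form $u_\omega(x',x_N)=\widetilde u(x_N)$ with $-\widetilde u''=f(\widetilde u)$ in $(0,1)$, $\widetilde u'(0)=\widetilde u(1)=0$; $u_\omega$ also denotes $\widetilde u$. $u_\omega$ is degenerate in $H^1_{0,x_N}(\Omega_\omega\cup\Gamma)$ if the linearized operator $-\Delta-f'(u_\omega)$ has $0$ as an eigenvalue in that space, i.e.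 if the problem $-z''-f'(u_\omega)z=0$ in $(0,1)$, $z'(0)=z(1)=0$ has a nontrivial solution; it is nondegenerate otherwise. *)

theory Defs
  imports "HOL-Analysis.Analysis"
begin

section \<open>Smooth functions and smooth bounded domains\<close>

primrec Ck_on :: "nat \<Rightarrow> ('a::real_normed_vector \<Rightarrow> 'b::real_normed_vector) \<Rightarrow> 'a set \<Rightarrow> bool"
  where
    "Ck_on 0 g S \<longleftrightarrow> continuous_on S g"
  | "Ck_on (Suc k) g S \<longleftrightarrow> (\<forall>x\<in>S. g differentiable (at x)) \<and>
       (\<forall>v. Ck_on k (\<lambda>x. frechet_derivative g (at x) v) S)"

definition smooth_on :: "('a::real_normed_vector \<Rightarrow> 'b::real_normed_vector) \<Rightarrow> 'a set \<Rightarrow> bool"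
  where "smooth_on g S \<longleftrightarrow> (\<forall>k. Ck_on k g S)"

text \<open>Near each boundary point the set is the region above a smooth graph in some direction
  \<open>e\<close>; the graph function does not depend on the \<open>e\<close>-coordinate (so it is constant in
  dimension one).\<close>

definition smooth_boundary :: "'a::euclidean_space set \<Rightarrow> bool"
  where "smooth_boundary \<omega> \<longleftrightarrow>
    (\<forall>p\<in>frontier \<omega>. \<exists>r>0. \<exists>e \<gamma>. norm e = 1 \<and> smooth_on \<gamma> UNIV \<and>
       (\<forall>x t. \<gamma> (x + t *\<^sub>R e) = \<gamma> x) \<and>
       \<omega> \<inter> ball p r = {x \<in> ball p r. (\<gamma> x :: real) < x \<bullet> e})"

definition smooth_bounded_domain :: "'a::euclidean_space set \<Rightarrow> bool"
  where "smooth_bounded_domain \<omega> \<longleftrightarrow>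
    open \<omega> \<and> connected \<omega> \<and> \<omega> \<noteq> {} \<and> bounded \<omega> \<and> smooth_boundary \<omega>"

section \<open>The nonlinearity\<close>

text \<open>Hoelder continuity of the derivative is required on bounded intervals only, so that
  nonlinearities with superlinear growth are admitted.\<close>

definition C1_holder :: "real \<Rightarrow> (real \<Rightarrow> real) \<Rightarrow> bool"
  where "C1_holder \<alpha> f \<longleftrightarrow> (\<forall>s. f differentiable (at s)) \<and>
    (\<forall>R. \<exists>C. \<forall>s\<in>{-R..R}. \<forall>t\<in>{-R..R}. \<bar>deriv f s - deriv f t\<bar> \<le> C * \<bar>s - t\<bar> powr \<alpha>)"

section \<open>Sobolev functions\<close>

definition L2_on :: "'a::euclidean_space set \<Rightarrow> ('a \<Rightarrow> 'b::euclidean_space) \<Rightarrow> bool"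
  where "L2_on S u \<longleftrightarrow> u \<in> borel_measurable (lebesgue_on S) \<and>
    integrable (lebesgue_on S) (\<lambda>x. (norm (u x))\<^sup>2)"

definition L2_tendsto ::
    "'a::euclidean_space set \<Rightarrow> (nat \<Rightarrow> 'a \<Rightarrow> 'b::euclidean_space) \<Rightarrow> ('a \<Rightarrow> 'b) \<Rightarrow> bool"
  where "L2_tendsto S \<phi> u \<longleftrightarrow> (\<forall>n. L2_on S (\<phi> n)) \<and> L2_on S u \<and>
    (\<lambda>n. integral\<^sup>L (lebesgue_on S) (\<lambda>x. (norm (\<phi> n x - u x))\<^sup>2)) \<longlonglongrightarrow> 0"

definition test_function :: "'a::euclidean_space set \<Rightarrow> ('a \<Rightarrow> real) \<Rightarrow> bool"
  where "test_function S \<phi> \<longleftrightarrow> smooth_on \<phi> UNIV \<and>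
    compact (closure {x. \<phi> x \<noteq> 0}) \<and> closure {x. \<phi> x \<noteq> 0} \<subseteq> S"

text \<open>\<open>u\<close> belongs to \<open>H\<^sup>1(S)\<close> and \<open>G\<close> is its weak gradient (determined almost everywhere).\<close>

definition has_weak_gradient ::
    "'a::euclidean_space set \<Rightarrow> ('a \<Rightarrow> real) \<Rightarrow> ('a \<Rightarrow> 'a) \<Rightarrow> bool"
  where "has_weak_gradient S u G \<longleftrightarrow> L2_on S u \<and> L2_on S G \<and>
    (\<forall>\<phi> D\<phi>. test_function S \<phi> \<and> (\<forall>x. GDERIV \<phi> x :> D\<phi> x) \<longrightarrow>
       integral\<^sup>L (lebesgue_on S) (\<lambda>x. u x *\<^sub>R D\<phi> x) =
         - integral\<^sup>L (lebesgue_on S) (\<lambda>x. \<phi> x *\<^sub>R G x))"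

definition H1 :: "'a::euclidean_space set \<Rightarrow> ('a \<Rightarrow> real) set"
  where "H1 S = {u. \<exists>G. has_weak_gradient S u G}"

section \<open>The cylinder and its function spaces\<close>

definition cyl :: "'a::euclidean_space set \<Rightarrow> ('a \<times> real) set"
  where "cyl \<omega> = \<omega> \<times> {0<..<1}"

text \<open>\<open>g\<close> is the trace of \<open>u\<close> on \<open>\<Gamma>\<^sub>0 = \<omega> \<times> {1}\<close>, the trace operator being the continuous
  extension from \<open>H\<^sup>1\<close> to \<open>L\<^sup>2(\<Gamma>\<^sub>0)\<close> of the restriction map on \<open>C\<^sup>1\<close> functions on the whole
  space. As \<open>\<Gamma>\<^sub>0\<close> is flat, its surface measure is Lebesgue measure on \<open>\<omega>\<close>.\<close>

definition has_trace :: "'a::euclidean_space set \<Rightarrow> ('a \<times> real \<Rightarrow> real) \<Rightarrow> ('a \<Rightarrow> real) \<Rightarrow> bool"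
  where "has_trace \<omega> u g \<longleftrightarrow> (\<exists>G \<phi> D\<phi>. has_weak_gradient (cyl \<omega>) u G \<and>
    (\<forall>n. (\<forall>x. GDERIV (\<phi> n) x :> D\<phi> n x) \<and> continuous_on UNIV (D\<phi> n)) \<and>
    L2_tendsto (cyl \<omega>) \<phi> u \<and> L2_tendsto (cyl \<omega>) D\<phi> G \<and>
    L2_tendsto \<omega> (\<lambda>n x'. \<phi> n (x', 1)) g)"

text \<open>\<open>H\<^sup>1\<^sub>0(\<Omega>\<^sub>\<omega> \<union> \<Gamma>)\<close> and its subspace of functions of \<open>x\<^sub>N\<close> only.\<close>

definition H10 :: "'a::euclidean_space set \<Rightarrow> ('a \<times> real \<Rightarrow> real) set"
  where "H10 \<omega> = {u \<in> H1 (cyl \<omega>). has_trace \<omega> u (\<lambda>_. 0)}"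

definition H10_xN :: "'a::euclidean_space set \<Rightarrow> ('a \<times> real \<Rightarrow> real) set"
  where "H10_xN \<omega> = {u \<in> H10 \<omega>. \<exists>\<zeta>. AE x in lebesgue_on (cyl \<omega>). u x = \<zeta> (snd x)}"

section \<open>Solutions and nondegeneracy\<close>

text \<open>The Neumann condition on \<open>\<Gamma>\<close> is the natural boundary condition of the weak formulation.\<close>

definition weak_solution ::
    "(real \<Rightarrow> real) \<Rightarrow> 'a::euclidean_space set \<Rightarrow> ('a \<times> real \<Rightarrow> real) \<Rightarrow> bool"
  where "weak_solution f \<omega> u \<longleftrightarrow> u \<in> H10 \<omega> \<and>
    (\<forall>v\<in>H10 \<omega>. \<forall>Gu Gv.
       has_weak_gradient (cyl \<omega>) u Gu \<and> has_weak_gradient (cyl \<omega>) v Gv \<longrightarrow>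
       integrable (lebesgue_on (cyl \<omega>)) (\<lambda>x. f (u x) * v x) \<and>
       integral\<^sup>L (lebesgue_on (cyl \<omega>)) (\<lambda>x. Gu x \<bullet> Gv x) =
         integral\<^sup>L (lebesgue_on (cyl \<omega>)) (\<lambda>x. f (u x) * v x))"

text \<open>\<open>w'\<close> below is the derivative of the profile \<open>w\<close>, one-sided at the endpoints.\<close>

definition one_dim_profile :: "(real \<Rightarrow> real) \<Rightarrow> (real \<Rightarrow> real) \<Rightarrow> bool"
  where "one_dim_profile f w \<longleftrightarrow> (\<exists>w'.
    (\<forall>t\<in>{0..1}. (w has_real_derivative w' t) (at t within {0..1})) \<and>
    (\<forall>t\<in>{0<..<1}. (w' has_real_derivative - f (w t)) (at t)) \<and>
    continuous_on {0..1} w' \<and> w' 0 = 0 \<and> w 1 = 0)"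

definition one_dim_solution ::
    "(real \<Rightarrow> real) \<Rightarrow> 'a::euclidean_space set \<Rightarrow> ('a \<times> real \<Rightarrow> real) \<Rightarrow> bool"
  where "one_dim_solution f \<omega> u \<longleftrightarrow>
    (\<exists>w. one_dim_profile f w \<and> (\<forall>x\<in>cyl \<omega>. u x = w (snd x)))"

text \<open>\<open>\<mu>\<close> is an eigenvalue, in the weak sense, of \<open>-\<Delta> - f'(u)\<close> in the subspace \<open>V\<close> of
  \<open>H\<^sup>1\<^sub>0(\<Omega>\<^sub>\<omega> \<union> \<Gamma>)\<close>. Quantifying over all weak gradients is harmless, since they agree almost
  everywhere and exist for the elements of \<open>V\<close>.\<close>

definition linearized_eigenvalue ::
    "(real \<Rightarrow> real) \<Rightarrow> 'a::euclidean_space set \<Rightarrow> ('a \<times> real \<Rightarrow> real) \<Rightarrow>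
     ('a \<times> real \<Rightarrow> real) set \<Rightarrow> real \<Rightarrow> bool"
  where "linearized_eigenvalue f \<omega> u V \<mu> \<longleftrightarrow>
    (\<exists>z\<in>V. \<not> (AE x in lebesgue_on (cyl \<omega>). z x = 0) \<and>
      (\<forall>v\<in>V. \<forall>Gz Gv.
         has_weak_gradient (cyl \<omega>) z Gz \<and> has_weak_gradient (cyl \<omega>) v Gv \<longrightarrow>
         integral\<^sup>L (lebesgue_on (cyl \<omega>)) (\<lambda>x. Gz x \<bullet> Gv x)
           - integral\<^sup>L (lebesgue_on (cyl \<omega>)) (\<lambda>x. deriv f (u x) * z x * v x)
         = \<mu> * integral\<^sup>L (lebesgue_on (cyl \<omega>)) (\<lambda>x. z x * v x)))"

definition degenerate_xN ::
    "(real \<Rightarrow> real) \<Rightarrow> 'a::euclidean_space set \<Rightarrow> ('a \<times> real \<Rightarrow> real) \<Rightarrow> bool"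
  where "degenerate_xN f \<omega> u \<longleftrightarrow> linearized_eigenvalue f \<omega> u (H10_xN \<omega>) 0"

end

theory Submission
  imports Defs
begin

text \<open>
  A degenerate direction is a nonzero function \<open>z\<close> of \<open>x\<^sub>N\<close> alone which
  satisfies, in the weak sense on the cylinder, the linearized equation. Two things have to be shown:
  that \<open>z\<close> is a classical solution of the linearized boundary value problem
  \<open>- z'' = f'(w) z\<close>, \<open>z'(0) = z(1) = 0\<close> on the interval, where \<open>w\<close> is the profile of the given
  solution, and that this problem has only the zero solution.

  For the first part, let \<open>\<phi>\<close> be a \<open>C\<^sup>2\<close> function of one variable with \<open>\<phi>'(0) = \<phi>(1) = 0\<close>. Then
  \<open>\<phi>(x\<^sub>N)\<close> is an admissible test function (\<open>vertical_test_function\<close>). In the tested equation one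
  further integration by parts, justified by the approximants that witness the zero trace of \<open>z\<close>
  (\<open>zero_trace_integration_by_parts\<close>), moves the remaining derivative from \<open>z\<close> to \<open>\<phi>\<close>. So \<open>z\<close> is
  orthogonal to all \<open>\<phi>'' + f'(w) \<phi>\<close>. The symmetry of the Green function of the mixed boundary value
  problem then shows that \<open>z\<close> coincides almost everywhere with a classical solution
  (\<open>very_weak_solution_regular\<close>).

  The second part (\<open>linearized_ode_trivial\<close>) is a Sturm comparison. Three functions are compared: \<open>z\<close>
  and \<open>w'\<close> solve the same linear equation with coefficient \<open>f'(w)\<close>, and \<open>w\<close> solves one with the
  smaller coefficient \<open>f(w) / w\<close>. Hence the Wronskian \<open>W\<close> of \<open>z\<close> and \<open>w'\<close> is constant, while
  \<open>J = w' z - w z'\<close> satisfies \<open>J' = (f'(w) - f(w) / w) w z\<close>. The boundary conditions give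
  \<open>J(0) = J(1) = 0\<close>. Let \<open>z \<noteq> 0\<close> be normalized so that \<open>W > 0\<close>. If \<open>J \<le> 0\<close> at \<open>1\<close> or at a critical
  point of \<open>w\<close>, then \<open>J < 0\<close> at the preceding critical point (\<open>wronskian_sign_step\<close>). There are
  finitely many critical points and \<open>0\<close> is the first, so \<open>J(0) < 0\<close>, a contradiction.
\<close>

section \<open>Antiderivatives and integrals on an interval\<close>

lemma antiderivative_exists:
  fixes h :: "real \<Rightarrow> real"
  assumes "continuous_on UNIV h"
  obtains H where "\<And>t. (H has_real_derivative h t) (at t)" "H a = 0"
proof -
  have "\<exists>F. \<forall>x :: real. -\<infinity> < ereal x \<longrightarrow> ereal x < \<infinity> \<longrightarrow> (F has_vector_derivative h x) (at x)"
    by (rule einterval_antiderivative) (use assms in \<open>auto simp: continuous_on_eq_continuous_at\<close>)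
  then obtain F where F: "\<And>x. (F has_real_derivative h x) (at x)"
    by (auto simp: has_real_derivative_iff_has_vector_derivative)
  show ?thesis
  proof (rule that[of "\<lambda>t. F t - F a"])
    show "((\<lambda>t. F t - F a) has_real_derivative h t) (at t)" for t
      by (auto intro!: derivative_eq_intros F)
  qed simp
qed

lemma DERIV_everywhere_continuous:
  fixes h :: "real \<Rightarrow> real"
  assumes "\<And>t. (h has_real_derivative h' t) (at t)"
  shows "continuous_on A h"
  by (rule DERIV_continuous_on, rule has_field_derivative_at_within, rule assms)

lemma integrable_Ioo_continuous:
  fixes h :: "real \<Rightarrow> real"
  assumes "continuous_on {a..b} h"
  shows "integrable lborel (\<lambda>t. indicator {a<..<b} t * h t)"
proof -
  have "set_integrable lborel {a..b} h"
    using assms unfolding set_integrable_def by (intro borel_integrable_compact) auto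
  then have "set_integrable lborel {a<..<b} h"
    by (rule set_integrable_subset) auto
  then show ?thesis by (simp add: set_integrable_def)
qed

lemma integral_Ioo_FTC:
  fixes F h :: "real \<Rightarrow> real"
  assumes "a \<le> b" "\<And>t. a \<le> t \<Longrightarrow> t \<le> b \<Longrightarrow> (F has_real_derivative h t) (at t)" "continuous_on {a..b} h"
  shows "integral\<^sup>L lborel (\<lambda>t. indicator {a<..<b} t * h t) = F b - F a"
proof -
  have "integral\<^sup>L lborel (\<lambda>t. indicator {a<..<b} t * h t)
      = integral\<^sup>L lborel (\<lambda>t. indicator {a..b} t *\<^sub>R h t)"
  proof (rule integral_cong_AE)
    show "(\<lambda>t. indicator {a<..<b} t * h t) \<in> borel_measurable lborel"
      using integrable_Ioo_continuous[OF assms(3)] by measurable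
    show "(\<lambda>t. indicator {a..b} t *\<^sub>R h t) \<in> borel_measurable lborel"
      using borel_integrable_compact[OF compact_Icc assms(3)] by measurable
    show "AE t in lborel. indicator {a<..<b} t * h t = indicator {a..b} t *\<^sub>R h t"
      using AE_lborel_singleton[of a] AE_lborel_singleton[of b]
      by eventually_elim (auto simp: indicator_def)
  qed
  also have "\<dots> = F b - F a"
    using assms(2,3)
    by (intro integral_FTC_Icc[OF assms(1)])
       (auto simp: has_real_derivative_iff_has_vector_derivative[symmetric]
          intro: has_field_derivative_at_within)
  finally show ?thesis .
qed

text \<open>The positive and negative parts of \<open>\<mu>\<close> are densities of two finite measures. Approximating the
  indicator of a half line by continuous ramps shows that these measures agree on half lines,
  hence everywhere.\<close>

lemma integral_against_continuous_zero:
  fixes \<mu> :: "real \<Rightarrow> real"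
  assumes \<mu>: "integrable lborel \<mu>"
    and zero: "\<And>h. continuous_on UNIV h \<Longrightarrow> integral\<^sup>L lborel (\<lambda>t. \<mu> t * h t) = 0"
  shows "AE t in lborel. \<mu> t = 0"
proof -
  have [measurable]: "\<mu> \<in> borel_measurable borel" using \<mu> by auto
  have half_line: "integral\<^sup>L lborel (\<lambda>t. \<mu> t * indicator {b<..} t) = 0" for b
  proof -
    define h where "h n t = min 1 (max 0 (real n * (t - b)))" for n t
    have conth: "continuous_on UNIV (h n)" for n unfolding h_def by (intro continuous_intros)
    have [measurable]: "h n \<in> borel_measurable borel" for n
      using conth by (rule borel_measurable_continuous_onI)
    have "(\<lambda>n. integral\<^sup>L lborel (\<lambda>t. \<mu> t * h n t)) \<longlonglongrightarrow> integral\<^sup>L lborel (\<lambda>t. \<mu> t * indicator {b<..} t)"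
    proof (rule integral_dominated_convergence[where w = "\<lambda>t. norm (\<mu> t)"])
      show "AE t in lborel. (\<lambda>n. \<mu> t * h n t) \<longlonglongrightarrow> \<mu> t * indicator {b<..} t"
      proof (intro AE_I2 tendsto_mult tendsto_const)
        fix t
        show "(\<lambda>n. h n t) \<longlonglongrightarrow> indicator {b<..} t"
        proof (cases "b < t")
          case True
          obtain N where N: "1 / (t - b) < real N" using reals_Archimedean2 by blast
          have "h n t = 1" if "n \<ge> N" for n
          proof -
            have "1 / (t - b) < real n" using N that by simp
            then have "1 < real n * (t - b)" using True by (simp add: divide_simps)
            then show ?thesis by (simp add: h_def)
          qed
          then have "\<forall>\<^sub>F n in sequentially. h n t = 1" using eventually_sequentially by blast
          then show ?thesis using True by (simp add: tendsto_eventually)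
        next
          case False
          then have "real n * (t - b) \<le> 0" for n by (simp add: mult_nonneg_nonpos)
          then have "max 0 (real n * (t - b)) = 0" for n by (rule max_absorb1)
          then have "h n t = 0" for n by (simp add: h_def)
          then show ?thesis using False by simp
        qed
      qed
      show "AE t in lborel. norm (\<mu> t * h n t) \<le> norm (\<mu> t)" for n
        by (intro AE_I2) (auto simp: abs_mult h_def intro!: mult_left_le)
    qed (use \<mu> in auto)
    then show ?thesis using zero[OF conth] by (simp add: LIMSEQ_const_iff)
  qed
  define P where "P t = max 0 (\<mu> t)" for t
  define N where "N t = max 0 (- \<mu> t)" for t
  have [measurable]: "P \<in> borel_measurable borel" "N \<in> borel_measurable borel"
    unfolding P_def N_def by measurable
  have int: "integrable lborel P" "integrable lborel N"
    using \<mu> unfolding P_def N_def by auto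
  have pn: "0 \<le> P t" "0 \<le> N t" "P t - N t = \<mu> t" for t by (auto simp: P_def N_def)
  have em: "emeasure (density lborel (\<lambda>t. ennreal (g t))) {b<..}
      = ennreal (integral\<^sup>L lborel (\<lambda>t. g t * indicator {b<..} t))"
    if "integrable lborel g" "\<And>t. 0 \<le> g t" for g :: "real \<Rightarrow> real" and b
  proof -
    have "integrable lborel (\<lambda>t. g t * indicator {b<..} t)"
      using that(1) by (intro integrable_real_mult_indicator) auto
    then have "(\<integral>\<^sup>+t. ennreal (g t * indicator {b<..} t) \<partial>lborel)
        = ennreal (integral\<^sup>L lborel (\<lambda>t. g t * indicator {b<..} t))"
      using that(2) by (intro nn_integral_eq_integral) auto
    then show ?thesis using that
      by (subst emeasure_density) (auto simp: ennreal_mult' ennreal_indicator)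
  qed
  have eq: "density lborel (\<lambda>t. ennreal (P t)) = density lborel (\<lambda>t. ennreal (N t))"
  proof (rule measure_eqI_lessThan)
    fix b
    show "emeasure (density lborel (\<lambda>t. ennreal (P t))) {b<..} < \<infinity>"
      by (subst em) (use int pn in auto)
    have "integral\<^sup>L lborel (\<lambda>t. P t * indicator {b<..} t) - integral\<^sup>L lborel (\<lambda>t. N t * indicator {b<..} t)
        = integral\<^sup>L lborel (\<lambda>t. P t * indicator {b<..} t - N t * indicator {b<..} t)"
      using int by (intro Bochner_Integration.integral_diff[symmetric] integrable_real_mult_indicator) auto
    also have "\<dots> = 0" using half_line[of b] by (simp flip: pn(3) add: left_diff_distrib)
    finally show "emeasure (density lborel (\<lambda>t. ennreal (P t))) {b<..}
        = emeasure (density lborel (\<lambda>t. ennreal (N t))) {b<..}"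
      using int pn by (simp add: em)
  qed auto
  have "AE t in lborel. ennreal (P t) = ennreal (N t)"
    using eq by (intro iffD1[OF sigma_finite_measure.density_unique_iff[OF lborel.sigma_finite_measure_axioms]]) auto
  then show ?thesis
  proof eventually_elim
    case (elim t)
    then have "P t = N t" using pn by (simp add: ennreal_inj)
    then show ?case using pn(3)[of t] by simp
  qed
qed

section \<open>Sturm comparison for the linearized ordinary differential equation\<close>

text \<open>The comparison step between two neighbouring critical points of \<open>w\<close> (or the last one and the
  right end point, where \<open>w = 0\<close>). Here \<open>p = w'\<close>, \<open>y = z'\<close>, and \<open>g\<close> and \<open>q\<close> stand for \<open>f(w)\<close> and
  \<open>f'(w)\<close>. The function \<open>w\<close> increases from a negative minimum to a nonnegative value and vanishes
  once, at \<open>t\<close>. Two monotone quantities are played against each other. Since \<open>z\<close> and \<open>p\<close> solve the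
  same linear equation with Wronskian \<open>c > 0\<close>, the quotient \<open>z / p\<close> increases, which controls the
  sign of \<open>z\<close>. Since \<open>w\<close> solves \<open>w'' + (g / w) w = 0\<close> with the smaller coefficient \<open>g / w < q\<close>, the
  derivative of \<open>J = p z - w y\<close> has the sign of \<open>w z\<close>. If \<open>z t \<le> 0\<close> then \<open>w\<close> and \<open>z\<close> are both negative
  before \<open>t\<close>, so \<open>J r < J t \<le> 0\<close>; if \<open>z t > 0\<close> then both are positive after \<open>t\<close>, and
  \<open>0 < J t < J e\<close> contradicts the assumption at \<open>e\<close>.\<close>

lemma wronskian_sign_step:
  fixes w p g z y q :: "real \<Rightarrow> real"
  assumes re: "r < e"
    and dw: "\<And>t. r < t \<Longrightarrow> t < e \<Longrightarrow> (w has_real_derivative p t) (at t)"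
    and dp: "\<And>t. r < t \<Longrightarrow> t < e \<Longrightarrow> (p has_real_derivative - g t) (at t)"
    and dz: "\<And>t. r < t \<Longrightarrow> t < e \<Longrightarrow> (z has_real_derivative y t) (at t)"
    and dy: "\<And>t. r < t \<Longrightarrow> t < e \<Longrightarrow> (y has_real_derivative - (q t * z t)) (at t)"
    and cont: "continuous_on {r..e} w" "continuous_on {r..e} p"
      "continuous_on {r..e} z" "continuous_on {r..e} y"
    and g_sign: "\<And>t. w t \<noteq> 0 \<Longrightarrow> 0 < w t * g t"
    and superlinear: "\<And>t. w t \<noteq> 0 \<Longrightarrow> w t * g t < q t * (w t)\<^sup>2"
    and wronskian: "\<And>t. r < t \<Longrightarrow> t < e \<Longrightarrow> y t * p t + z t * g t = c"
    and c: "0 < c"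
    and no_double_zero: "\<And>t. r \<le> t \<Longrightarrow> t \<le> e \<Longrightarrow> w t \<noteq> 0 \<or> p t \<noteq> 0"
    and p_pos: "\<And>t. r < t \<Longrightarrow> t < e \<Longrightarrow> 0 < p t"
    and pr: "p r = 0"
    and e: "w e = 0 \<or> p e = 0"
    and Je: "p e * z e - w e * y e \<le> 0"
  shows "p r * z r - w r * y r < 0"
proof -
  define J where "J = (\<lambda>t. p t * z t - w t * y t)"
  have sub: "continuous_on {a..b} h" if "continuous_on {r..e} h" "r \<le> a" "b \<le> e"
    for a b and h :: "real \<Rightarrow> real"
    by (rule continuous_on_subset[OF that(1)]) (use that in auto)
  have w_mono: "w a < w b" if "r \<le> a" "a < b" "b \<le> e" for a b
  proof (rule DERIV_pos_imp_increasing_open[OF that(2)])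
    fix x assume "a < x" "x < b"
    then have "r < x" "x < e" using that by auto
    then show "\<exists>d. (w has_real_derivative d) (at x) \<and> 0 < d" using dw[of x] p_pos[of x] by blast
  qed (intro sub[OF cont(1)] that)
  have wr: "w r < 0"
  proof (rule ccontr)
    assume "\<not> w r < 0"
    with no_double_zero[of r] pr re have wr: "0 < w r" by auto
    define m where "m = (r + e) / 2"
    have m: "r < m" "m < e" using re by (auto simp: m_def)
    have "p r > p m"
    proof (intro DERIV_neg_imp_decreasing_open[OF m(1)] sub[OF cont(2)])
      fix t assume t: "r < t" "t < m"
      have "0 < w t" using w_mono[of r t] t m wr by auto
      then have "0 < g t" using g_sign[of t] by (auto simp: zero_less_mult_iff)
      then show "\<exists>d. (p has_real_derivative d) (at t) \<and> d < 0"
        using dp[of t] t m by (intro exI[of _ "- g t"]) auto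
    qed (use m in auto)
    with pr p_pos[OF m] show False by simp
  qed
  have we: "0 \<le> w e"
  proof (rule ccontr)
    assume neg: "\<not> 0 \<le> w e"
    with e have pe: "p e = 0" by auto
    define m where "m = (r + e) / 2"
    have m: "r < m" "m < e" using re by (auto simp: m_def)
    have "p m < p e"
    proof (intro DERIV_pos_imp_increasing_open[OF m(2)] sub[OF cont(2)])
      fix t assume t: "m < t" "t < e"
      have "w t < 0" using w_mono[of t e] t m neg by auto
      then have "g t < 0" using g_sign[of t] by (auto simp: zero_less_mult_iff)
      then show "\<exists>d. (p has_real_derivative d) (at t) \<and> 0 < d"
        using dp[of t] t m by (intro exI[of _ "- g t"]) auto
    qed (use m in auto)
    with pe p_pos[OF m] show False by simp
  qed
  obtain t where t: "r \<le> t" "t \<le> e" "w t = 0"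
    using IVT'[of w r 0 e] wr we re cont(1) by auto
  have rt: "r < t" using t wr by (cases "r = t") auto
  have pt: "0 < p t"
  proof (cases "t = e")
    case True
    have "0 \<le> p e"
    proof (rule tendsto_lowerbound)
      show "(p \<longlongrightarrow> p e) (at_left e)"
        using cont(2) re continuous_on_Icc_at_leftD by blast
      show "\<forall>\<^sub>F x in at_left e. 0 \<le> p x"
        using eventually_at_left_real[OF re] by eventually_elim (use p_pos in force)
    qed simp
    with True t no_double_zero[of e] re show ?thesis by force
  qed (use t p_pos rt in auto)
  \<comment> \<open>The Wronskian identity says that \<open>(z / p)' = c / p\<^sup>2\<close>.\<close>
  have quot: "z a / p a < z b / p b" if "r < a" "a < b" "b \<le> e" "0 < p b" for a b
  proof (intro DERIV_pos_imp_increasing_open[OF \<open>a < b\<close>, of "\<lambda>x. z x / p x"])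
    fix x assume x: "a < x" "x < b"
    then have px: "0 < p x" and x': "r < x" "x < e" using p_pos that by auto
    have "((\<lambda>x. z x / p x) has_real_derivative (y x * p x - z x * - g x) / (p x * p x)) (at x)"
      using px x' by (intro DERIV_divide dz dp) auto
    moreover have "(y x * p x - z x * - g x) / (p x * p x) > 0"
      using wronskian[OF x'] c px by simp
    ultimately show "\<exists>d. ((\<lambda>x. z x / p x) has_real_derivative d) (at x) \<and> 0 < d" by blast
  next
    have "p x \<noteq> 0" if "x \<in> {a..b}" for x
      using that \<open>r < a\<close> \<open>b \<le> e\<close> \<open>0 < p b\<close> p_pos[of x] by (cases "x = b") auto
    then show "continuous_on {a..b} (\<lambda>x. z x / p x)"
      using that by (intro continuous_on_divide sub[OF cont(2)] sub[OF cont(3)]) auto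
  qed
  have dJ: "(J has_real_derivative z x * (q x * w x - g x)) (at x)" if "r < x" "x < e" for x
    unfolding J_def using that
    by (auto intro!: derivative_eq_intros dw dp dz dy simp: algebra_simps)
  have contJ: "continuous_on {a..b} J" if "r \<le> a" "b \<le> e" for a b
    unfolding J_def using that by (intro continuous_intros sub[OF cont(1)] sub[OF cont(2)] sub[OF cont(3)] sub[OF cont(4)]) auto
  show ?thesis
  proof (cases "z t \<le> 0")
    case True
    have "J r < J t"
    proof (intro DERIV_pos_imp_increasing_open[OF rt] contJ)
      fix x assume x: "r < x" "x < t"
      have px: "0 < p x" using x t p_pos by auto
      have "z x / p x < 0"
        using quot[of x t] x t pt True by (meson divide_nonpos_pos order_less_le_trans)
      then have zx: "z x < 0" using px by (simp add: divide_less_0_iff)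
      have wx: "w x < 0" using w_mono[of x t] x t by auto
      have "w x * g x < w x * (q x * w x)"
        using superlinear[of x] wx by (simp add: power2_eq_square algebra_simps)
      then have "q x * w x - g x < 0" using wx by simp
      then have "0 < z x * (q x * w x - g x)" using zx by (simp add: mult_neg_neg)
      then show "\<exists>d. (J has_real_derivative d) (at x) \<and> 0 < d" using dJ[of x] x t by auto
    qed (use t in auto)
    also have "J t \<le> 0" using t pt True by (simp add: J_def mult_nonneg_nonpos)
    finally show ?thesis by (simp add: J_def)
  next
    case False
    have Jt: "0 < J t" using t pt False by (simp add: J_def)
    then have te: "t < e" using t Je by (cases "t = e") (auto simp: J_def)
    have "J t < J e"
    proof (intro DERIV_pos_imp_increasing_open[OF te] contJ)
      fix x assume x: "t < x" "x < e"
      have px: "0 < p x" using x rt p_pos by auto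
      have "0 < z t / p t" using False pt by simp
      then have "z x / p x > 0"
        using quot[of t x] x t rt px by auto
      then have zx: "z x > 0" using px by (simp add: zero_less_divide_iff)
      have wx: "w x > 0" using w_mono[of t x] x t by auto
      have "w x * g x < w x * (q x * w x)"
        using superlinear[of x] wx by (simp add: power2_eq_square algebra_simps)
      then have "q x * w x - g x > 0" using wx by simp
      then have "0 < z x * (q x * w x - g x)" using zx by simp
      then show "\<exists>d. (J has_real_derivative d) (at x) \<and> 0 < d" using dJ[of x] x rt by auto
    qed (use t in auto)
    with Jt Je show ?thesis by (simp add: J_def)
  qed
qed

text \<open>The energy \<open>w'\<^sup>2 / 2 + F(w)\<close>, where \<open>F' = f\<close> and \<open>F(0) = 0\<close>, is conserved. The sign condition
  makes \<open>F\<close> positive away from \<open>0\<close>, so a point with \<open>w = w' = 0\<close> would force \<open>w\<close> to vanish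
  identically. This avoids any uniqueness theorem for the nonlinear initial value problem.\<close>

lemma no_double_zero_of_nonlinear:
  fixes f w p :: "real \<Rightarrow> real"
  assumes f: "continuous_on UNIV f" "\<And>s. s \<noteq> 0 \<Longrightarrow> 0 < s * f s"
    and dw: "\<And>t. 0 < t \<Longrightarrow> t < 1 \<Longrightarrow> (w has_real_derivative p t) (at t)"
    and dp: "\<And>t. 0 < t \<Longrightarrow> t < 1 \<Longrightarrow> (p has_real_derivative - f (w t)) (at t)"
    and cont: "continuous_on {0..1} w" "continuous_on {0..1} p"
    and t: "t \<in> {0..1}" "w t \<noteq> 0" and s: "s \<in> {0..1}"
  shows "w s \<noteq> 0 \<or> p s \<noteq> 0"
proof (rule ccontr)
  assume neg: "\<not> (w s \<noteq> 0 \<or> p s \<noteq> 0)"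
  obtain F where dF: "\<And>x. (F has_real_derivative f x) (at x)" and F0: "F 0 = 0"
    using antiderivative_exists[OF f(1)] by blast
  have contF: "continuous_on A F" for A
    using dF by (rule DERIV_everywhere_continuous)
  have F_pos: "0 < F x" if "x \<noteq> 0" for x
  proof (cases "0 < x")
    case True
    have "F 0 < F x"
    proof (rule DERIV_pos_imp_increasing_open[OF True _ contF])
      fix u :: real assume "0 < u"
      then have "0 < f u" using f(2)[of u] by (simp add: zero_less_mult_iff)
      then show "\<exists>d. (F has_real_derivative d) (at u) \<and> 0 < d" using dF by blast
    qed
    then show ?thesis using F0 by simp
  next
    case False
    then have "x < 0" using that by simp
    then have "F x > F 0"
    proof (rule DERIV_neg_imp_decreasing_open[OF _ _ contF])
      fix u :: real assume "u < 0"
      then have "f u < 0" using f(2)[of u] by (simp add: zero_less_mult_iff)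
      then show "\<exists>d. (F has_real_derivative d) (at u) \<and> d < 0" using dF by blast
    qed
    then show ?thesis using F0 by simp
  qed
  \<comment> \<open>The energy of \<open>w'' + f(w) = 0\<close>: kinetic plus potential part.\<close>
  define E where "E x = (p x)\<^sup>2 / 2 + F (w x)" for x
  have "E x = E 0" if "x \<in> {0..1}" for x
  proof (cases "x = 0")
    case False
    then have x: "0 < x" "x \<le> 1" using that by auto
    have contw: "continuous_on {0..x} w" and contp: "continuous_on {0..x} p"
      using x by (auto intro: continuous_on_subset[OF cont(1)] continuous_on_subset[OF cont(2)])
    have contFw: "continuous_on {0..x} (\<lambda>x. F (w x))"
      by (rule continuous_on_compose2[OF contF[of UNIV] contw]) auto
    show ?thesis
    proof (rule DERIV_isconst_end[OF x(1), of E])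
      show "continuous_on {0..x} E" unfolding E_def
        by (intro continuous_intros contFw contp) auto
      fix u assume u: "0 < u" "u < x"
      then have u': "0 < u" "u < 1" using x by auto
      show "(E has_real_derivative 0) (at u)" unfolding E_def
        by (rule derivative_eq_intros dp[OF u'] DERIV_chain2[OF dF dw[OF u']] refl | simp add: algebra_simps)+
    qed
  qed simp
  then have "E t = E s" using t s by metis
  moreover have "E s = 0" using neg F0 by (simp add: E_def)
  moreover have "0 < E t" using F_pos[OF t(2)] by (simp add: E_def add_nonneg_pos)
  ultimately show False by simp
qed

text \<open>Gronwall's argument: \<open>(z\<^sup>2 + y\<^sup>2) exp (- K t)\<close> is nonincreasing when \<open>1 + \<bar>q\<bar> \<le> K\<close>.\<close>

lemma linear_ode_zero_data:
  fixes z y q :: "real \<Rightarrow> real"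
  assumes dz: "\<And>t. 0 < t \<Longrightarrow> t < 1 \<Longrightarrow> (z has_real_derivative y t) (at t)"
    and dy: "\<And>t. 0 < t \<Longrightarrow> t < 1 \<Longrightarrow> (y has_real_derivative - (q t * z t)) (at t)"
    and cont: "continuous_on {0..1} z" "continuous_on {0..1} y" "continuous_on {0..1} q"
    and zero: "z 0 = 0" "y 0 = 0" and t: "t \<in> {0..1}"
  shows "z t = 0"
proof -
  have "compact (q ` {0..1})" using cont(3) by (intro compact_continuous_image) auto
  then obtain M where M: "\<And>x. x \<in> {0..1} \<Longrightarrow> \<bar>q x\<bar> \<le> M"
    by (metis (no_types, lifting) bounded_iff compact_imp_bounded image_eqI real_norm_def)
  define K where "K = 1 + M"
  define E where "E x = ((z x)\<^sup>2 + (y x)\<^sup>2) * exp (- K * x)" for x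
  have "E t \<le> E 0"
  proof (rule DERIV_nonpos_imp_decreasing_open[of 0 t E])
    show "0 \<le> t" using t by simp
    show "continuous_on {0..t} E" unfolding E_def
      by (intro continuous_intros)
         (use t in \<open>auto intro: continuous_on_subset[OF cont(1)] continuous_on_subset[OF cont(2)]\<close>)
    fix u assume u: "0 < u" "u < t"
    then have u': "0 < u" "u < 1" using t by auto
    have "(E has_real_derivative
        (2 * z u * y u * (1 - q u) - K * ((z u)\<^sup>2 + (y u)\<^sup>2)) * exp (- K * u)) (at u)"
      unfolding E_def
      by (rule derivative_eq_intros dz[OF u'] dy[OF u'] refl | simp add: algebra_simps)+
    moreover have "2 * z u * y u * (1 - q u) \<le> K * ((z u)\<^sup>2 + (y u)\<^sup>2)"
    proof -
      have "2 * z u * y u * (1 - q u) \<le> \<bar>2 * z u * y u\<bar> * \<bar>1 - q u\<bar>"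
        by (metis abs_ge_self abs_mult)
      also have "\<dots> \<le> ((z u)\<^sup>2 + (y u)\<^sup>2) * K"
      proof (intro mult_mono)
        show "\<bar>2 * z u * y u\<bar> \<le> (z u)\<^sup>2 + (y u)\<^sup>2"
          using sum_squares_bound[of "\<bar>z u\<bar>" "\<bar>y u\<bar>"] by (simp add: abs_mult)
        show "\<bar>1 - q u\<bar> \<le> K" using M[of u] u' by (auto simp: K_def)
      qed auto
      finally show ?thesis by (simp add: mult.commute)
    qed
    ultimately show "\<exists>d. (E has_real_derivative d) (at u) \<and> d \<le> 0"
      by (meson diff_le_0_iff_le exp_ge_zero mult_nonpos_nonneg)
  qed
  then have "E t \<le> 0" by (simp add: E_def zero)
  then have "(z t)\<^sup>2 + (y t)\<^sup>2 \<le> 0" by (simp add: E_def mult_le_0_iff)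
  then show ?thesis by (metis sum_power2_le_zero_iff)
qed

text \<open>The one-dimensional nondegeneracy statement. It is Sturm's comparison argument without counting
  zeros: a solution \<open>z\<close> of the linearized problem that is not identically zero has nonzero Wronskian
  with \<open>w'\<close>, because that Wronskian is \<open>z(0) f(w(0))\<close>. The quantity \<open>J = w' z - w z'\<close> vanishes at
  both ends of the interval. Starting from \<open>J = 0\<close> at \<open>1\<close>, and with the Wronskian normalized to be
  positive, \<open>J\<close> is shown to be negative at one critical point of \<open>w\<close> after the other, going left,
  and so also at \<open>0\<close>.\<close>

lemma linearized_ode_trivial:
  fixes f w p z y :: "real \<Rightarrow> real"
  assumes f: "\<And>s. (f has_real_derivative f' s) (at s)" "continuous_on UNIV f'"
    and f_sign: "\<And>s. s \<noteq> 0 \<Longrightarrow> 0 < s * f s"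
    and f_super: "\<And>s. s \<noteq> 0 \<Longrightarrow> f s / s < f' s"
    and dw: "\<And>t. 0 < t \<Longrightarrow> t < 1 \<Longrightarrow> (w has_real_derivative p t) (at t)"
    and dp: "\<And>t. 0 < t \<Longrightarrow> t < 1 \<Longrightarrow> (p has_real_derivative - f (w t)) (at t)"
    and contw: "continuous_on {0..1} w" and contp: "continuous_on {0..1} p"
    and w_bc: "p 0 = 0" "w 1 = 0"
    and nontriv: "\<exists>t\<in>{0..1}. w t \<noteq> 0"
    and dz: "\<And>t. 0 < t \<Longrightarrow> t < 1 \<Longrightarrow> (z has_real_derivative y t) (at t)"
    and dy: "\<And>t. 0 < t \<Longrightarrow> t < 1 \<Longrightarrow> (y has_real_derivative - (f' (w t) * z t)) (at t)"
    and contz: "continuous_on {0..1} z" and conty: "continuous_on {0..1} y"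
    and z_bc: "y 0 = 0" "z 1 = 0"
    and t: "t \<in> {0..1}"
  shows "z t = 0"
proof -
  have contf: "continuous_on A f" for A
    using f(1) by (rule DERIV_everywhere_continuous)
  have contf': "continuous_on {0..1} (\<lambda>t. f' (w t))"
    using f(2) contw by (rule continuous_on_compose2) auto
  have no_double: "w s \<noteq> 0 \<or> p s \<noteq> 0" if "s \<in> {0..1}" for s
    using nontriv no_double_zero_of_nonlinear[OF contf f_sign dw dp contw contp _ _ that] by blast
  \<comment> \<open>\<open>W\<close> is the Wronskian \<open>y p - z p'\<close> of the two solutions \<open>z\<close> and \<open>p = w'\<close> of the linearized
    equation, hence constant.\<close>
  define W where "W x = y x * p x + z x * f (w x)" for x
  have W: "W x = W 0" if "x \<in> {0..1}" for x
  proof (cases "x = 0")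
    case False
    then have x: "0 < x" "x \<le> 1" using that by auto
    have sub: "continuous_on {0..x} h" if "continuous_on {0..1} h" for h :: "real \<Rightarrow> real"
      using that by (rule continuous_on_subset) (use x in auto)
    have contfw: "continuous_on {0..x} (\<lambda>x. f (w x))"
      by (rule continuous_on_compose2[OF contf[of UNIV] sub[OF contw]]) auto
    show ?thesis
    proof (rule DERIV_isconst_end[OF x(1), of W])
      show "continuous_on {0..x} W" unfolding W_def
        using sub[OF contp] sub[OF contz] sub[OF conty] contfw
        by (intro continuous_on_add continuous_on_mult)
      show "(W has_real_derivative 0) (at u)" if u: "0 < u" "u < x" for u
      proof -
        have u': "0 < u" "u < 1" using u x by auto
        show ?thesis unfolding W_def
          by (rule derivative_eq_intros dp[OF u'] dz[OF u'] dy[OF u'] DERIV_chain2[OF f(1) dw[OF u']] refl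
             | simp add: algebra_simps)+
      qed
    qed
  qed simp
  \<comment> \<open>Critical points of \<open>w\<close> cannot accumulate: at an accumulation point \<open>w \<noteq> 0\<close>.\<close>
  have fin: "finite {s\<in>{0..1}. p s = 0}" (is "finite ?C")
  proof (rule ccontr)
    assume "infinite ?C"
    moreover have "?C \<subseteq> {0..1}" by auto
    ultimately obtain l where l: "l \<in> {0..1}" "l islimpt ?C"
      using Heine_Borel_imp_Bolzano_Weierstrass[of "{0..1::real}" ?C] by (metis compact_Icc)
    have "closed ?C"
      by (rule continuous_closed_preimage_constant[OF contp closed_real_atLeastAtMost])
    then have "l \<in> ?C" using l(2) unfolding closed_limpt by blast
    then have pl: "p l = 0" by simp
    then have wl: "w l \<noteq> 0" using no_double l by auto
    have "continuous (at l within {0..1}) w"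
      using contw l(1) unfolding continuous_on_eq_continuous_within by blast
    from continuous_within_avoid[OF this wl] obtain d
      where d: "d > 0" "\<And>x. x \<in> {0..1} \<Longrightarrow> dist l x < d \<Longrightarrow> w x \<noteq> 0"
      by blast
    obtain s where s: "s \<in> ?C" "s \<noteq> l" "dist s l < d"
      using l(2) d(1) unfolding islimpt_approachable by blast
    \<comment> \<open>Rolle's theorem for \<open>p\<close> between the two critical points produces a zero of \<open>w\<close>.\<close>
    define a b where "a = min s l" and "b = max s l"
    have ab: "a < b" "p a = p b" "0 \<le> a" "b \<le> 1"
      using s l pl by (auto simp: a_def b_def min_def max_def)
    have "\<exists>x>a. x < b \<and> (p has_real_derivative 0) (at x)"
    proof (rule Rolle[OF ab(1,2)])
      show "continuous_on {a..b} p" by (rule continuous_on_subset[OF contp]) (use ab in auto)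
      show "p differentiable at x" if "a < x" "x < b" for x
        using dp[of x] that ab real_differentiable_def by fastforce
    qed
    then obtain x where x: "a < x" "x < b" "(p has_real_derivative 0) (at x)" by auto
    have "f (w x) = 0" using DERIV_unique[OF x(3) dp[of x]] x ab by auto
    moreover have "w x \<noteq> 0"
      using x ab s by (intro d) (auto simp: dist_real_def a_def b_def min_def max_def split: if_splits)
    ultimately show False using f_sign[of "w x"] by simp
  qed
  \<comment> \<open>Changing the sign of \<open>z\<close> changes the sign of \<open>W\<close>, so only the case \<open>W > 0\<close> needs the
    descent along critical points.\<close>
  have pos_case: False
    if pos: "0 < zz 0 * f (w 0)"
      and zz: "\<And>t. 0 < t \<Longrightarrow> t < 1 \<Longrightarrow> (zz has_real_derivative yy t) (at t)"
        "\<And>t. 0 < t \<Longrightarrow> t < 1 \<Longrightarrow> (yy has_real_derivative - (f' (w t) * zz t)) (at t)"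
        "continuous_on {0..1} zz" "continuous_on {0..1} yy" "yy 0 = 0" "zz 1 = 0"
        "\<And>x. x \<in> {0..1} \<Longrightarrow> yy x * p x + zz x * f (w x) = zz 0 * f (w 0)" for zz yy
  proof -
    define J where "J s = p s * zz s - w s * yy s" for s
    \<comment> \<open>The sign of \<open>J\<close> is propagated from \<open>e\<close> to the preceding critical point \<open>r\<close> of \<open>w\<close>.\<close>
    have prev_crit: "\<exists>r\<in>?C. r < e \<and> J r < 0"
      if e: "0 < e" "e \<le> 1" "J e \<le> 0" "w e = 0 \<or> p e = 0" for e
    proof -
      define r where "r = Max (?C \<inter> {..<e})"
      have fr: "finite (?C \<inter> {..<e})" using fin by blast
      have "r \<in> ?C \<inter> {..<e}" unfolding r_def
        using fr e w_bc by (intro Max_in) auto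
      then have r: "0 \<le> r" "r < e" "p r = 0" by auto
      have p_ne: "p x \<noteq> 0" if "r < x" "x < e" for x
        using Max_ge[OF fr, of x] that r e by (force simp: r_def)
      define m where "m = (r + e) / 2"
      have m: "r < m" "m < e" using r by (auto simp: m_def)
      have same_sign: "0 < p m * p x" if x: "r < x" "x < e" for x
      proof (rule ccontr)
        assume *: "\<not> 0 < p m * p x"
        have conn: "connected (p ` {r<..<e})"
          by (intro connected_continuous_image continuous_on_subset[OF contp]) (use r e in auto)
        have "0 \<in> p ` {r<..<e}"
        proof -
          have "p m \<in> p ` {r<..<e}" "p x \<in> p ` {r<..<e}" using m x by auto
          moreover have "p m \<le> 0 \<and> 0 \<le> p x \<or> p x \<le> 0 \<and> 0 \<le> p m"
            using * by (auto simp: zero_less_mult_iff not_less)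
          ultimately show ?thesis using conn by (meson connected_contains_Icc atLeastAtMost_iff subsetD)
        qed
        then show False using p_ne by auto
      qed
      have super: "s * f s < f' s * s\<^sup>2" if "s \<noteq> 0" for s
      proof -
        have "f s / s * s\<^sup>2 < f' s * s\<^sup>2" using f_super[OF that] that by (intro mult_strict_right_mono) auto
        then show ?thesis using that by (simp add: power2_eq_square mult.commute)
      qed
      have sub: "continuous_on {r..e} h" if "continuous_on {0..1} h" for h :: "real \<Rightarrow> real"
        using that by (rule continuous_on_subset) (use r e in auto)
      have "J r < 0"
      proof (cases "0 < p m")
        case True
        have "p r * zz r - w r * yy r < 0"
        proof (rule wronskian_sign_step[where e = e and g = "\<lambda>t. f (w t)" and q = "\<lambda>t. f' (w t)"
              and c = "zz 0 * f (w 0)" and w = "w" and p = "p" and z = "zz" and y = "yy"])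
          fix t assume t: "r < t" "t < e"
          then have t': "0 < t" "t < 1" using r e by auto
          show "(w has_real_derivative p t) (at t)"
            by (rule dw[OF t'])
          show "(p has_real_derivative - (f (w t))) (at t)"
            by (rule dp[OF t'])
          show "(zz has_real_derivative yy t) (at t)"
            by (rule zz(1)[OF t'])
          show "(yy has_real_derivative - (f' (w t) * zz t)) (at t)"
            by (rule zz(2)[OF t'])
          show "yy t * p t + zz t * f (w t) = zz 0 * f (w 0)"
            using zz(7)[of t] t' by simp
          show "0 < p t"
            using same_sign[OF t] True by (simp add: zero_less_mult_iff)
        next
          fix t :: real
          assume "w t \<noteq> 0"
          then have "w t \<noteq> 0" by simp
          then show "0 < w t * f (w t)" "w t * f (w t) < f' (w t) * (w t)\<^sup>2"
            using f_sign[of "w t"] super[of "w t"] by simp_all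
        next
          fix t assume "r \<le> t" "t \<le> e"
          then show "w t \<noteq> 0 \<or> p t \<noteq> 0" using no_double[of t] r e by simp
        next
          show "r < e" "p r = 0" "0 < zz 0 * f (w 0)" "w e = 0 \<or> p e = 0"
            "p e * zz e - w e * yy e \<le> 0"
            using r pos e by (simp_all add: J_def)
        qed (intro continuous_intros sub[OF contw] sub[OF contp] sub[OF zz(3)] sub[OF zz(4)])+
        then show ?thesis by (simp add: J_def)
      next
        case False
        \<comment> \<open>Reverse the signs of \<open>w\<close> and \<open>z\<close> simultaneously; this leaves \<open>J\<close> and \<open>W\<close> unchanged.\<close>
        have "- p r * - zz r - - w r * - yy r < 0"
        proof (rule wronskian_sign_step[where e = e and g = "\<lambda>t. - f (w t)" and q = "\<lambda>t. f' (w t)"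
              and c = "zz 0 * f (w 0)" and w = "\<lambda>t. - w t" and p = "\<lambda>t. - p t" and z = "\<lambda>t. - zz t" and y = "\<lambda>t. - yy t"])
          fix t assume t: "r < t" "t < e"
          then have t': "0 < t" "t < 1" using r e by auto
          show "((\<lambda>t. - w t) has_real_derivative - p t) (at t)"
            by (rule DERIV_minus[OF dw[OF t']])
          show "((\<lambda>t. - p t) has_real_derivative - (- f (w t))) (at t)"
            by (rule DERIV_minus[OF dp[OF t']])
          show "((\<lambda>t. - zz t) has_real_derivative - yy t) (at t)"
            by (rule DERIV_minus[OF zz(1)[OF t']])
          show "((\<lambda>t. - yy t) has_real_derivative - (f' (w t) * - zz t)) (at t)"
            using DERIV_minus[OF zz(2)[OF t']] by simp
          show "- yy t * - p t + - zz t * - f (w t) = zz 0 * f (w 0)"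
            using zz(7)[of t] t' by simp
          show "0 < - p t"
            using same_sign[OF t] False by (simp add: zero_less_mult_iff)
        next
          fix t :: real
          assume "- w t \<noteq> 0"
          then have "w t \<noteq> 0" by simp
          then show "0 < - w t * - f (w t)" "- w t * - f (w t) < f' (w t) * (- w t)\<^sup>2"
            using f_sign[of "w t"] super[of "w t"] by simp_all
        next
          fix t assume "r \<le> t" "t \<le> e"
          then show "- w t \<noteq> 0 \<or> - p t \<noteq> 0" using no_double[of t] r e by simp
        next
          show "r < e" "- p r = 0" "0 < zz 0 * f (w 0)" "- w e = 0 \<or> - p e = 0"
            "- p e * - zz e - - w e * - yy e \<le> 0"
            using r pos e by (simp_all add: J_def)
        qed (intro continuous_intros sub[OF contw] sub[OF contp] sub[OF zz(3)] sub[OF zz(4)])+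
        then show ?thesis by (simp add: J_def)
      qed
      with r e show ?thesis by auto
    qed
    \<comment> \<open>Started from the end point \<open>1\<close>, where \<open>J = 0\<close>, the descent cannot stop before \<open>0\<close>,
      and there it contradicts \<open>J 0 = 0\<close>.\<close>
    define S where "S = {s\<in>?C. J s < 0}"
    have "S \<noteq> {}" using prev_crit[of 1] w_bc zz by (auto simp: S_def J_def)
    moreover have "finite S" using fin unfolding S_def by (rule rev_finite_subset) blast
    ultimately have "Min S \<in> S" by (intro Min_in)
    then have s: "0 \<le> Min S" "Min S \<le> 1" "p (Min S) = 0" "J (Min S) < 0" unfolding S_def by simp_all
    have "J 0 = 0" using w_bc zz by (simp add: J_def)
    then have "Min S \<noteq> 0" using s by force
    then obtain r where r: "r \<in> ?C" "r < Min S" "J r < 0"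
      using prev_crit[of "Min S"] s by force
    then have "r \<in> S" unfolding S_def by blast
    with \<open>finite S\<close> r show False by (meson Min_le not_less)
  qed
  have W0: "y x * p x + z x * f (w x) = z 0 * f (w 0)" if "x \<in> {0..1}" for x
    using W[OF that] unfolding W_def z_bc by simp
  have "\<not> 0 < z 0 * f (w 0)"
  proof
    assume "0 < z 0 * f (w 0)"
    then show False by (rule pos_case[OF _ dz dy contz conty z_bc W0])
  qed
  moreover have "\<not> z 0 * f (w 0) < 0"
  proof
    assume "z 0 * f (w 0) < 0"
    then have neg: "0 < - z 0 * f (w 0)" by simp
    show False
    proof (rule pos_case[where zz = "\<lambda>t. - z t" and yy = "\<lambda>t. - y t"])
      fix t :: real assume t: "0 < t" "t < 1"
      show "((\<lambda>t. - z t) has_real_derivative - y t) (at t)" by (rule DERIV_minus[OF dz[OF t]])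
      show "((\<lambda>t. - y t) has_real_derivative - (f' (w t) * - z t)) (at t)"
        using DERIV_minus[OF dy[OF t]] by simp
    next
      fix x :: real assume "x \<in> {0..1}"
      from W0[OF this] show "- y x * p x + - z x * f (w x) = - z 0 * f (w 0)" by simp
    qed (use z_bc neg in \<open>auto intro: continuous_on_minus contz conty\<close>)
  qed
  ultimately have "z 0 * f (w 0) = 0" by linarith
  moreover have "f (w 0) \<noteq> 0"
  proof
    assume "f (w 0) = 0"
    then have "w 0 = 0" using f_sign[of "w 0"] by auto
    then show False using no_double[of 0] w_bc by simp
  qed
  ultimately have "z 0 = 0" by simp
  then show ?thesis
    by - (rule linear_ode_zero_data[where z = z and y = y and q = "\<lambda>t. f' (w t)", OF dz dy contz conty contf' _ z_bc(1) t])
qed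

section \<open>Very weak solutions of the linearized equation on the interval\<close>

lemma green_problem_solvable:
  fixes h :: "real \<Rightarrow> real"
  assumes "continuous_on UNIV h"
  obtains \<phi> \<phi>' where "\<And>t. (\<phi> has_real_derivative \<phi>' t) (at t)"
    "\<And>t. (\<phi>' has_real_derivative h t) (at t)" "\<phi>' 0 = 0" "\<phi> 1 = 0"
proof -
  obtain \<phi>' where 1: "\<And>t. (\<phi>' has_real_derivative h t) (at t)" "\<phi>' 0 = 0"
    using antiderivative_exists[OF assms] by blast
  obtain \<phi> where 2: "\<And>t. (\<phi> has_real_derivative \<phi>' t) (at t)" "\<phi> 1 = 0"
    using antiderivative_exists[OF DERIV_everywhere_continuous[OF 1(1)]] by blast
  show ?thesis by (rule that[OF 2(1) 1 2(2)])
qed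

text \<open>The Green function of \<open>- d\<^sup>2/ds\<^sup>2\<close> with a Neumann condition at \<open>0\<close> and a Dirichlet condition
  at \<open>1\<close> is \<open>1 - max t s\<close>. On \<open>{t..1}\<close> an antiderivative of \<open>(1 - s) h s\<close> is \<open>(1 - s) \<phi>' s + \<phi> s\<close>.\<close>

lemma green_representation:
  fixes \<phi> \<phi>' h :: "real \<Rightarrow> real"
  assumes d: "\<And>t. (\<phi> has_real_derivative \<phi>' t) (at t)" "\<And>t. (\<phi>' has_real_derivative h t) (at t)"
    and h: "continuous_on UNIV h" and bc: "\<phi>' 0 = 0" "\<phi> 1 = 0" and t: "0 \<le> t" "t \<le> 1"
  shows "integral\<^sup>L lborel (\<lambda>s. indicator {0<..<1} s * ((1 - max t s) * h s)) = - \<phi> t"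
proof -
  have c: "continuous_on A h" for A using h by (rule continuous_on_subset) simp
  have i1: "integrable lborel (\<lambda>s. indicator {0<..<t} s * ((1 - t) * h s))"
    by (intro integrable_Ioo_continuous continuous_intros c)
  have i2: "integrable lborel (\<lambda>s. indicator {t<..<1} s * ((1 - s) * h s))"
    by (intro integrable_Ioo_continuous continuous_intros c)
  have "integral\<^sup>L lborel (\<lambda>s. indicator {0<..<1} s * ((1 - max t s) * h s))
     = integral\<^sup>L lborel (\<lambda>s. indicator {0<..<t} s * ((1 - t) * h s) + indicator {t<..<1} s * ((1 - s) * h s))"
  proof (rule integral_cong_AE)
    show "AE s in lborel. indicator {0<..<1} s * ((1 - max t s) * h s) =
        indicator {0<..<t} s * ((1 - t) * h s) + indicator {t<..<1} s * ((1 - s) * h s)"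
      using AE_lborel_singleton[of t] by eventually_elim (use t in \<open>auto simp: indicator_def max_def\<close>)
    have "integrable lborel (\<lambda>s. indicator {0<..<1} s * ((1 - max t s) * h s))"
      by (intro integrable_Ioo_continuous continuous_intros c)
    then show "(\<lambda>s. indicator {0<..<1} s * ((1 - max t s) * h s)) \<in> borel_measurable lborel"
      by measurable
    show "(\<lambda>s. indicator {0<..<t} s * ((1 - t) * h s) + indicator {t<..<1} s * ((1 - s) * h s))
        \<in> borel_measurable lborel"
      using i1 i2 by measurable
  qed
  also have "\<dots> = integral\<^sup>L lborel (\<lambda>s. indicator {0<..<t} s * ((1 - t) * h s))
      + integral\<^sup>L lborel (\<lambda>s. indicator {t<..<1} s * ((1 - s) * h s))"
    using i1 i2 by (rule Bochner_Integration.integral_add)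
  also have "integral\<^sup>L lborel (\<lambda>s. indicator {0<..<t} s * ((1 - t) * h s)) = (1 - t) * \<phi>' t - (1 - t) * \<phi>' 0"
    using t by (intro integral_Ioo_FTC) (auto intro!: derivative_eq_intros continuous_intros d c)
  also have "integral\<^sup>L lborel (\<lambda>s. indicator {t<..<1} s * ((1 - s) * h s))
      = ((1 - 1) * \<phi>' 1 + \<phi> 1) - ((1 - t) * \<phi>' t + \<phi> t)"
  proof (rule integral_Ioo_FTC[where F = "\<lambda>s. (1 - s) * \<phi>' s + \<phi> s"])
    show "((\<lambda>s. (1 - s) * \<phi>' s + \<phi> s) has_real_derivative (1 - s) * h s) (at s)" for s
      by (rule derivative_eq_intros d refl | simp add: algebra_simps)+
  qed (use t in \<open>auto intro!: continuous_intros c\<close>)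
  finally show ?thesis using bc by (simp add: algebra_simps)
qed

text \<open>A one-dimensional regularity result: an integrable function orthogonal to all \<open>\<phi>'' + q \<phi>\<close>, with
  \<open>\<phi>\<close> satisfying the boundary conditions \<open>\<phi>'(0) = \<phi>(1) = 0\<close>, is almost everywhere a classical
  solution with the same boundary conditions. Writing \<open>\<phi>\<close> through the Green function, whose kernel is
  symmetric, and exchanging the integrals turns the hypothesis into \<open>\<integral> (\<zeta> - r) h = 0\<close> for all
  continuous \<open>h\<close>, where \<open>r\<close> is the Green potential of \<open>q \<zeta>\<close>. Hence \<open>\<zeta> = r\<close> almost everywhere;
  as \<open>r\<close> is continuous and is the Green potential of \<open>q r\<close>, it is twice differentiable.\<close>

lemma very_weak_solution_regular:
  fixes \<zeta> q :: "real \<Rightarrow> real"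
  assumes q: "continuous_on UNIV q"
    and meas: "\<zeta> \<in> borel_measurable borel"
    and int: "integrable lborel (\<lambda>t. indicator {0<..<1} t * \<zeta> t)"
    and weak: "\<And>\<phi> \<phi>' h. (\<And>t. (\<phi> has_real_derivative \<phi>' t) (at t)) \<Longrightarrow>
      (\<And>t. (\<phi>' has_real_derivative h t) (at t)) \<Longrightarrow> continuous_on UNIV h \<Longrightarrow> \<phi>' 0 = 0 \<Longrightarrow> \<phi> 1 = 0 \<Longrightarrow>
      integral\<^sup>L lborel (\<lambda>t. indicator {0<..<1} t * (\<zeta> t * (h t + q t * \<phi> t))) = 0"
  obtains R y where "\<And>t. (R has_real_derivative y t) (at t)"
    "\<And>t. 0 < t \<Longrightarrow> t < 1 \<Longrightarrow> (y has_real_derivative - (q t * R t)) (at t)"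
    "continuous_on UNIV y" "y 0 = 0" "R 1 = 0"
    "AE t in lborel. 0 < t \<and> t < 1 \<longrightarrow> \<zeta> t = R t"
proof -
  let ?I = "\<lambda>t :: real. indicator {0<..<1} t :: real"
  note [measurable] = meas borel_measurable_continuous_onI[OF q]
  obtain Q where Q: "\<And>t. t \<in> {0<..<1} \<Longrightarrow> norm (q t) \<le> Q"
  proof -
    have "compact (q ` {0..1})"
      using q by (intro compact_continuous_image) (auto intro: continuous_on_subset)
    then obtain Q where "\<And>t. t \<in> {0..1} \<Longrightarrow> norm (q t) \<le> Q"
      by (metis bounded_iff compact_imp_bounded image_eqI)
    then show ?thesis by (intro that[of Q]) auto
  qed
  define g where "g t = ?I t * (q t * \<zeta> t)" for t
  have [measurable]: "g \<in> borel_measurable borel" unfolding g_def by measurable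
  have intg: "integrable lborel g"
  proof (rule Bochner_Integration.integrable_bound)
    show "integrable lborel (\<lambda>t. Q * (?I t * \<zeta> t))" using int by simp
    show "AE t in lborel. norm (g t) \<le> norm (Q * (?I t * \<zeta> t))"
    proof (rule AE_I2)
      fix t
      show "norm (g t) \<le> norm (Q * (?I t * \<zeta> t))"
        using Q[of t] by (auto simp: g_def indicator_def abs_mult intro!: mult_right_mono)
    qed
  qed simp
  define r where "r s = integral\<^sup>L lborel (\<lambda>t. (1 - max t s) * g t)" for s
  have int_kernel: "integrable lborel (\<lambda>t. (1 - max t s) * g t)" for s
  proof (rule Bochner_Integration.integrable_bound)
    show "integrable lborel (\<lambda>t. (2 + \<bar>s\<bar>) * g t)" using intg by simp
    show "AE t in lborel. norm ((1 - max t s) * g t) \<le> norm ((2 + \<bar>s\<bar>) * g t)"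
    proof (rule AE_I2)
      fix t
      show "norm ((1 - max t s) * g t) \<le> norm ((2 + \<bar>s\<bar>) * g t)"
        unfolding norm_mult
        by (cases "0 < t \<and> t < 1") (auto simp: g_def indicator_def intro!: mult_right_mono)
    qed
  qed simp
  have contr: "continuous_on UNIV r"
  proof -
    define L where "L = integral\<^sup>L lborel (\<lambda>t. norm (g t))"
    have "L \<ge> 0" by (simp add: L_def)
    have "\<bar>r s - r s'\<bar> \<le> L * \<bar>s - s'\<bar>" for s s'
    proof -
      have "r s - r s' = integral\<^sup>L lborel (\<lambda>t. (1 - max t s) * g t - (1 - max t s') * g t)"
        unfolding r_def using int_kernel by simp
      also have "\<bar>\<dots>\<bar> \<le> integral\<^sup>L lborel (\<lambda>t. \<bar>s - s'\<bar> * norm (g t))"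
      proof (rule integral_abs_bound_integral)
        show "integrable lborel (\<lambda>t. (1 - max t s) * g t - (1 - max t s') * g t)"
          using int_kernel by simp
        show "integrable lborel (\<lambda>t. \<bar>s - s'\<bar> * norm (g t))" using intg by simp
        fix t
        have "\<bar>(1 - max t s) * g t - (1 - max t s') * g t\<bar> = \<bar>max t s' - max t s\<bar> * \<bar>g t\<bar>"
          by (simp flip: abs_mult add: algebra_simps)
        also have "\<dots> \<le> \<bar>s - s'\<bar> * \<bar>g t\<bar>" by (intro mult_right_mono) auto
        finally show "\<bar>(1 - max t s) * g t - (1 - max t s') * g t\<bar> \<le> \<bar>s - s'\<bar> * norm (g t)" by simp
      qed
      finally show ?thesis by (simp add: L_def mult.commute)
    qed
    then have "L-lipschitz_on UNIV r"
      using \<open>L \<ge> 0\<close> by (auto simp: lipschitz_on_def dist_real_def)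
    then show ?thesis by (rule lipschitz_on_continuous_on)
  qed
  have [measurable]: "r \<in> borel_measurable borel" using contr by (rule borel_measurable_continuous_onI)
  have int_Ir: "integrable lborel (\<lambda>t. ?I t * r t)"
    by (intro integrable_Ioo_continuous continuous_on_subset[OF contr]) auto
  define \<mu> where "\<mu> t = ?I t * \<zeta> t - ?I t * r t" for t
  have int\<mu>: "integrable lborel \<mu>" unfolding \<mu>_def using int int_Ir by simp
  have "integral\<^sup>L lborel (\<lambda>t. \<mu> t * h t) = 0" if h: "continuous_on UNIV h" for h
  proof -
    note [measurable] = borel_measurable_continuous_onI[OF h]
    obtain \<phi> \<phi>' where \<phi>: "\<And>t. (\<phi> has_real_derivative \<phi>' t) (at t)"
      "\<And>t. (\<phi>' has_real_derivative h t) (at t)" "\<phi>' 0 = 0" "\<phi> 1 = 0"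
      using green_problem_solvable[OF h] by blast
    have cont\<phi>: "continuous_on A \<phi>" for A using \<phi>(1) by (rule DERIV_everywhere_continuous)
    have rep: "integral\<^sup>L lborel (\<lambda>s. ?I s * ((1 - max t s) * h s)) = - \<phi> t" if "0 < t" "t < 1" for t
      using green_representation[OF \<phi>(1,2) h \<phi>(3,4)] that by simp
    have inth: "integrable lborel (\<lambda>s. ?I s * h s)"
      by (intro integrable_Ioo_continuous continuous_on_subset[OF h]) auto
    have int_k: "integrable (lborel \<Otimes>\<^sub>M lborel) (\<lambda>(t, s). g t * (?I s * ((1 - max t s) * h s)))"
    proof (rule Bochner_Integration.integrable_bound)
      show "integrable (lborel \<Otimes>\<^sub>M lborel) (\<lambda>x. g (fst x) * (?I (snd x) * h (snd x)))"
      proof (rule lborel_pair.Fubini_integrable)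
        have "integrable lborel (\<lambda>t. norm (g t) * integral\<^sup>L lborel (\<lambda>s. norm (?I s * h s)))"
          using intg by simp
        then show "integrable lborel
            (\<lambda>t. integral\<^sup>L lborel (\<lambda>s. norm (g (fst (t, s)) * (?I (snd (t, s)) * h (snd (t, s))))))"
          by (simp add: abs_mult)
        show "AE t in lborel. integrable lborel (\<lambda>s. g (fst (t, s)) * (?I (snd (t, s)) * h (snd (t, s))))"
          using inth by simp
      qed measurable
      show "AE x in lborel \<Otimes>\<^sub>M lborel. norm (case x of (t, s) \<Rightarrow> g t * (?I s * ((1 - max t s) * h s)))
          \<le> norm (g (fst x) * (?I (snd x) * h (snd x)))"
      proof (rule AE_I2)
        fix x :: "real \<times> real"
        obtain t s where x: "x = (t, s)" by (cases x)
        have "\<bar>1 - max t s\<bar> * \<bar>h s\<bar> \<le> \<bar>h s\<bar>" if "0 < t" "t < 1" "0 < s" "s < 1"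
          using that by (intro mult_left_le_one_le) auto
        then show "norm (case x of (t, s) \<Rightarrow> g t * (?I s * ((1 - max t s) * h s)))
            \<le> norm (g (fst x) * (?I (snd x) * h (snd x)))"
          by (auto simp: x g_def indicator_def abs_mult intro!: mult_left_mono)
      qed
    qed measurable
    have int_I\<zeta>h: "integrable lborel (\<lambda>t. ?I t * \<zeta> t * h t)"
    proof -
      have "bounded (h ` {0..1})"
        using h by (intro compact_imp_bounded compact_continuous_image) (auto intro: continuous_on_subset)
      then obtain B where B: "\<And>t. t \<in> {0..1} \<Longrightarrow> norm (h t) \<le> B" by (metis bounded_iff image_eqI)
      show ?thesis
      proof (rule Bochner_Integration.integrable_bound)
        show "integrable lborel (\<lambda>t. B * (?I t * \<zeta> t))" using int by simp
        show "AE t in lborel. norm (?I t * \<zeta> t * h t) \<le> norm (B * (?I t * \<zeta> t))"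
        proof (rule AE_I2)
          fix t
          show "norm (?I t * \<zeta> t * h t) \<le> norm (B * (?I t * \<zeta> t))"
            using B[of t] by (auto simp: indicator_def abs_mult mult.commute[of B] intro!: mult_left_mono)
        qed
      qed measurable
    qed
    have int_gk: "integrable lborel (\<lambda>t. g t * - \<phi> t)" 
    proof -
      have "integrable lborel (\<lambda>t. integral\<^sup>L lborel (\<lambda>s. g t * (?I s * ((1 - max t s) * h s))))"
        using lborel_pair.integrable_fst'[OF int_k] by simp
      also have "(\<lambda>t. integral\<^sup>L lborel (\<lambda>s. g t * (?I s * ((1 - max t s) * h s)))) = (\<lambda>t. g t * - \<phi> t)"
        using rep by (auto simp: g_def indicator_def)
      finally show ?thesis .
    qed
    have swap: "integral\<^sup>L lborel (\<lambda>t. g t * - \<phi> t) = integral\<^sup>L lborel (\<lambda>s. ?I s * r s * h s)"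
    proof -
      have "integral\<^sup>L lborel (\<lambda>t. g t * - \<phi> t)
          = integral\<^sup>L lborel (\<lambda>t. integral\<^sup>L lborel (\<lambda>s. g t * (?I s * ((1 - max t s) * h s))))"
        by (rule Bochner_Integration.integral_cong) (use rep in \<open>auto simp: g_def indicator_def\<close>)
      also have "\<dots> = integral\<^sup>L lborel (\<lambda>s. integral\<^sup>L lborel (\<lambda>t. g t * (?I s * ((1 - max t s) * h s))))"
        using lborel_pair.Fubini_integral[OF int_k] by simp
      also have "\<dots> = integral\<^sup>L lborel (\<lambda>s. ?I s * h s * r s)"
      proof (rule Bochner_Integration.integral_cong)
        fix s
        have "integral\<^sup>L lborel (\<lambda>t. g t * (?I s * ((1 - max t s) * h s)))
            = integral\<^sup>L lborel (\<lambda>t. (?I s * h s) * ((1 - max t s) * g t))"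
          by (simp add: algebra_simps)
        also have "\<dots> = ?I s * h s * r s" unfolding r_def by simp
        finally show "integral\<^sup>L lborel (\<lambda>t. g t * (?I s * ((1 - max t s) * h s))) = ?I s * h s * r s" .
      qed simp
      finally show ?thesis by (simp add: algebra_simps)
    qed
    have int_Irh: "integrable lborel (\<lambda>t. ?I t * r t * h t)"
      unfolding mult.assoc
      by (intro integrable_Ioo_continuous continuous_on_mult continuous_on_subset[OF contr]
          continuous_on_subset[OF h]) auto
    have "0 = integral\<^sup>L lborel (\<lambda>t. ?I t * (\<zeta> t * (h t + q t * \<phi> t)))"
      using weak[OF \<phi>(1,2) h \<phi>(3,4)] by simp
    also have "\<dots> = integral\<^sup>L lborel (\<lambda>t. ?I t * \<zeta> t * h t - g t * - \<phi> t)"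
      by (rule Bochner_Integration.integral_cong) (auto simp: g_def algebra_simps)
    also have "\<dots> = integral\<^sup>L lborel (\<lambda>t. ?I t * \<zeta> t * h t) - integral\<^sup>L lborel (\<lambda>t. ?I t * r t * h t)"
      using int_I\<zeta>h int_gk swap by simp
    also have "\<dots> = integral\<^sup>L lborel (\<lambda>t. \<mu> t * h t)"
      using int_I\<zeta>h int_Irh by (simp add: \<mu>_def left_diff_distrib)
    finally show ?thesis by simp
  qed
  then have "AE t in lborel. \<mu> t = 0" by (rule integral_against_continuous_zero[OF int\<mu>])
  then have ae: "AE t in lborel. 0 < t \<and> t < 1 \<longrightarrow> \<zeta> t = r t"
    by eventually_elim (auto simp: \<mu>_def)
  have contqr: "continuous_on UNIV (\<lambda>t. q t * r t)" using q contr by (rule continuous_on_mult)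
  obtain \<phi> \<phi>' where \<phi>: "\<And>t. (\<phi> has_real_derivative \<phi>' t) (at t)"
    "\<And>t. (\<phi>' has_real_derivative q t * r t) (at t)" "\<phi>' 0 = 0" "\<phi> 1 = 0"
    using green_problem_solvable[OF contqr] by blast
  have r_eq: "r s = - \<phi> s" if "0 < s" "s < 1" for s
  proof -
    have "r s = integral\<^sup>L lborel (\<lambda>t. (1 - max t s) * g t)" by (rule r_def)
    also have "\<dots> = integral\<^sup>L lborel (\<lambda>t. ?I t * ((1 - max s t) * (q t * r t)))"
    proof (rule integral_cong_AE)
      show "AE t in lborel. (1 - max t s) * g t = ?I t * ((1 - max s t) * (q t * r t))"
        using ae by eventually_elim (auto simp: g_def indicator_def max.commute)
    qed measurable
    also have "\<dots> = - \<phi> s" using green_representation[OF \<phi>(1,2) contqr \<phi>(3,4)] that by simp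
    finally show ?thesis .
  qed
  show ?thesis
  proof (rule that[of "\<lambda>t. - \<phi> t" "\<lambda>t. - \<phi>' t"])
    show "((\<lambda>t. - \<phi> t) has_real_derivative - \<phi>' t) (at t)" for t by (rule DERIV_minus[OF \<phi>(1)])
    show "((\<lambda>t. - \<phi>' t) has_real_derivative - (q t * - \<phi> t)) (at t)" if "0 < t" "t < 1" for t
      using DERIV_minus[OF \<phi>(2), of t] r_eq[OF that] by simp
    show "continuous_on UNIV (\<lambda>t. - \<phi>' t)"
      by (intro continuous_on_minus DERIV_everywhere_continuous[OF \<phi>(2)])
    show "AE t in lborel. 0 < t \<and> t < 1 \<longrightarrow> \<zeta> t = - \<phi> t"
      using ae by eventually_elim (use r_eq in auto)
  qed (use \<phi> in auto)
qed

section \<open>Continuously differentiable functions as Sobolev functions\<close>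

lemma GDERIV_directional:
  assumes "GDERIV h x :> d"
  shows "(\<lambda>n. (h (x + (1 / real (Suc n)) *\<^sub>R b) - h x) * real (Suc n)) \<longlonglongrightarrow> d \<bullet> b"
proof -
  have "((\<lambda>s. h (x + s *\<^sub>R b)) has_derivative (\<lambda>s. (s *\<^sub>R b) \<bullet> d)) (at 0)"
  proof (rule has_derivative_compose[of "\<lambda>s. x + s *\<^sub>R b" _ 0 UNIV h "\<lambda>y. y \<bullet> d"])
    show "((\<lambda>s. x + s *\<^sub>R b) has_derivative (\<lambda>s. s *\<^sub>R b)) (at 0)"
      by (auto intro!: derivative_eq_intros)
    show "(h has_derivative (\<lambda>y. y \<bullet> d)) (at (x + 0 *\<^sub>R b))"
      using assms by (simp add: gderiv_def)
  qed
  then have "((\<lambda>s. h (x + s *\<^sub>R b)) has_real_derivative d \<bullet> b) (at 0)"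
    by (simp add: has_field_derivative_def inner_commute mult.commute[of _ "b \<bullet> d"] mult_commute_abs)
  then have "((\<lambda>s. (h (x + s *\<^sub>R b) - h x) / s) \<longlongrightarrow> d \<bullet> b) (at 0)"
    by (simp add: DERIV_def)
  moreover have "filterlim (\<lambda>n. 1 / real (Suc n)) (at 0) sequentially"
    unfolding filterlim_at using LIMSEQ_inverse_real_of_nat by (auto simp: field_simps)
  ultimately have "(\<lambda>n. (h (x + (1 / real (Suc n)) *\<^sub>R b) - h x) / (1 / real (Suc n))) \<longlonglongrightarrow> d \<bullet> b"
    by (rule filterlim_compose)
  then show ?thesis by simp
qed

lemma integral_lborel_translate:
  fixes h :: "'a::euclidean_space \<Rightarrow> 'b::{banach, second_countable_topology}"
  assumes "h \<in> borel_measurable borel"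
  shows "integral\<^sup>L lborel (\<lambda>x. h (x + c)) = integral\<^sup>L lborel h"
    and "integrable lborel h \<Longrightarrow> integrable lborel (\<lambda>x. h (x + c))"
proof -
  have m: "(+) c \<in> measurable lborel borel" by measurable
  have "integral\<^sup>L lborel h = integral\<^sup>L (distr lborel borel ((+) c)) h"
    by (simp add: lborel_distr_plus)
  also have "\<dots> = integral\<^sup>L lborel (\<lambda>x. h (c + x))"
    by (rule integral_distr[OF m assms])
  finally show "integral\<^sup>L lborel (\<lambda>x. h (x + c)) = integral\<^sup>L lborel h"
    by (simp add: add.commute)
  assume "integrable lborel h"
  then have "integrable (distr lborel borel ((+) c)) h" by (simp add: lborel_distr_plus)
  then have "integrable lborel (\<lambda>x. h (c + x))"
    using integrable_distr_eq[OF m assms] by simp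
  then show "integrable lborel (\<lambda>x. h (x + c))" by (simp add: add.commute)
qed

lemma integrable_lborel_compact_support:
  fixes h :: "'a::euclidean_space \<Rightarrow> 'b::{banach, second_countable_topology}"
  assumes "continuous_on UNIV h" "compact K" "\<And>x. x \<notin> K \<Longrightarrow> h x = 0"
  shows "integrable lborel h"
proof -
  have "integrable lborel (\<lambda>x. indicator K x *\<^sub>R h x)"
    using assms(2) continuous_on_subset[OF assms(1)] by (intro borel_integrable_compact) auto
  also have "(\<lambda>x. indicator K x *\<^sub>R h x) = h"
    using assms(3) by (auto simp: indicator_def)
  finally show ?thesis .
qed

lemma GDERIV_support:
  assumes "GDERIV h x :> d" "closed K" "\<And>y. y \<notin> K \<Longrightarrow> h y = 0" "x \<notin> K"
  shows "d = 0"
proof -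
  have "((\<lambda>_. 0) has_derivative (\<lambda>y. y \<bullet> d)) (at x)"
    using assms(1) unfolding gderiv_def
    by (rule has_derivative_transform_within_open[of _ _ _ _ "- K"]) (use assms in auto)
  then have "(\<lambda>y. y \<bullet> d) = (\<lambda>_. 0)"
    using has_derivative_unique[OF _ has_derivative_const] by blast
  then show ?thesis by (metis inner_eq_zero_iff)
qed

lemma GDERIV_continuous_on:
  assumes "\<And>x. GDERIV h x :> D x"
  shows "continuous_on A h"
  by (rule has_derivative_continuous_on[where f' = "\<lambda>x y. y \<bullet> D x"])
     (use assms in \<open>auto simp: gderiv_def intro: has_derivative_at_withinI\<close>)

text \<open>By translation invariance all difference quotients of \<open>h\<close> have integral zero; being bounded and
  supported in a common compact set, they converge under the integral.\<close>

lemma integral_gradient_compact_support: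
  fixes h :: "'a::euclidean_space \<Rightarrow> real"
  assumes D: "\<And>x. GDERIV h x :> D x" and contD: "continuous_on UNIV D"
    and K: "compact K" and h0: "\<And>x. x \<notin> K \<Longrightarrow> h x = 0"
  shows "integral\<^sup>L lborel D = 0"
proof (rule euclidean_eqI)
  fix b :: 'a assume b: "b \<in> Basis"
  have conth: "continuous_on UNIV h" using D by (rule GDERIV_continuous_on)
  have D0: "D x = 0" if "x \<notin> K" for x
    using GDERIV_support[OF D compact_imp_closed[OF K] h0 that] .
  have inth: "integrable lborel h"
    using conth K h0 by (rule integrable_lborel_compact_support)
  have intD: "integrable lborel D"
    using contD K D0 by (rule integrable_lborel_compact_support)
  have mh: "h \<in> borel_measurable borel"
    using conth by (rule borel_measurable_continuous_onI)
  have "compact (D ` K)"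
    using continuous_on_subset[OF contD] K by (intro compact_continuous_image) auto
  then obtain M0 where "\<And>x. x \<in> K \<Longrightarrow> norm (D x) \<le> M0"
    by (metis bounded_iff compact_imp_bounded image_eqI)
  then have M: "norm (D x) \<le> max M0 0" for x
    using D0[of x] by (cases "x \<in> K") (auto simp: le_max_iff_disj)
  define M where "M = max M0 0"
  \<comment> \<open>All the difference quotients are supported in the unit neighbourhood of \<open>K\<close>.\<close>
  define K' where "K' = {x + y | x y. x \<in> K \<and> y \<in> cball 0 1}"
  have K': "compact K'" unfolding K'_def using K by (intro compact_sums) auto
  define d where "d n x = (h (x + (1 / real (Suc n)) *\<^sub>R b) - h x) * real (Suc n)" for n x
  have d0: "integral\<^sup>L lborel (d n) = 0" for n
    unfolding d_def using inth integral_lborel_translate[OF mh] by simp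
  have bound: "norm (d n x) \<le> indicator K' x * M" for n x
  proof (cases "x \<in> K'")
    case True
    define s where "s = 1 / real (Suc n)"
    have "norm (h (x + s *\<^sub>R b) - h x) \<le> M * norm (x + s *\<^sub>R b - x)"
    proof (rule differentiable_bound[of UNIV h "\<lambda>x y. y \<bullet> D x"])
      show "(h has_derivative (\<lambda>y. y \<bullet> D u)) (at u within UNIV)" for u
        using D[of u] by (simp add: gderiv_def)
      show "onorm (\<lambda>y. y \<bullet> D u) \<le> M" for u
      proof (rule onorm_le)
        fix y
        have "norm (y \<bullet> D u) \<le> norm y * norm (D u)" by (simp add: Cauchy_Schwarz_ineq2)
        also have "\<dots> \<le> norm y * M" using M[of u] by (intro mult_left_mono) (auto simp: M_def)
        finally show "norm (y \<bullet> D u) \<le> M * norm y" by (simp add: mult.commute)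
      qed
    qed auto
    also have "\<dots> = M * s" using b by (simp add: s_def)
    finally have "norm (h (x + s *\<^sub>R b) - h x) * real (Suc n) \<le> M * s * real (Suc n)"
      by (rule mult_right_mono) simp
    then show ?thesis using True by (simp add: d_def s_def abs_mult)
  next
    case False
    have "x \<notin> K"
    proof
      assume "x \<in> K"
      then have "x + 0 \<in> K'" unfolding K'_def by fastforce
      with False show False by simp
    qed
    moreover have "x + (1 / real (Suc n)) *\<^sub>R b \<notin> K"
    proof
      assume *: "x + (1 / real (Suc n)) *\<^sub>R b \<in> K"
      have "- (1 / real (Suc n)) *\<^sub>R b \<in> cball 0 1" using b by (simp add: divide_simps)
      with * have "(x + (1 / real (Suc n)) *\<^sub>R b) + (- (1 / real (Suc n)) *\<^sub>R b) \<in> K'"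
        unfolding K'_def by blast
      with False show False by simp
    qed
    ultimately show ?thesis using h0 False by (simp add: d_def)
  qed
  have "(\<lambda>n. integral\<^sup>L lborel (d n)) \<longlonglongrightarrow> integral\<^sup>L lborel (\<lambda>x. D x \<bullet> b)"
  proof (rule integral_dominated_convergence)
    show "(\<lambda>x. D x \<bullet> b) \<in> borel_measurable lborel" using intD by measurable
    show "d n \<in> borel_measurable lborel" for n
      unfolding d_def using mh by measurable
    have "integrable lborel (\<lambda>x. indicator K' x *\<^sub>R M)"
      using K' by (intro borel_integrable_compact) auto
    then show "integrable lborel (\<lambda>x. indicator K' x * M)" by simp
    show "AE x in lborel. (\<lambda>n. d n x) \<longlonglongrightarrow> D x \<bullet> b"
      unfolding d_def using GDERIV_directional[OF D] by auto
    show "AE x in lborel. norm (d n x) \<le> indicator K' x * M" for n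
      using bound by auto
  qed
  then have "integral\<^sup>L lborel (\<lambda>x. D x \<bullet> b) = 0"
    by (simp add: d0 LIMSEQ_const_iff)
  then show "integral\<^sup>L lborel D \<bullet> b = 0 \<bullet> b"
    using intD by simp
qed

lemma integral_lebesgue_on_eq_lborel:
  fixes h :: "'a::euclidean_space \<Rightarrow> 'b::{banach, second_countable_topology}"
  assumes "S \<in> sets lebesgue" "h \<in> borel_measurable borel" "\<And>x. x \<notin> S \<Longrightarrow> h x = 0"
  shows "integral\<^sup>L (lebesgue_on S) h = integral\<^sup>L lborel h"
proof -
  have "integral\<^sup>L (lebesgue_on S) h = integral\<^sup>L lebesgue (\<lambda>x. indicator S x *\<^sub>R h x)"
    using assms(1) by (intro integral_restrict_space) simp
  also have "(\<lambda>x. indicator S x *\<^sub>R h x) = h" using assms(3) by (auto simp: indicator_def)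
  also have "integral\<^sup>L lebesgue h = integral\<^sup>L lborel h"
    using assms(2) by (intro integral_completion) simp
  finally show ?thesis .
qed

lemma finite_measure_bounded_open:
  fixes S :: "'a::euclidean_space set"
  assumes "open S" "bounded S"
  shows "finite_measure (lebesgue_on S)"
  using assms by (intro finite_measure_lebesgue_on lmeasurable_open)

lemma borel_measurable_lebesgue_on:
  assumes "h \<in> borel_measurable borel"
  shows "h \<in> borel_measurable (lebesgue_on S)"
  using assms by (intro measurable_restrict_space1 measurable_completion) simp

lemma bounded_image_continuous:
  fixes h :: "'a::euclidean_space \<Rightarrow> 'b::real_normed_vector"
  assumes "continuous_on UNIV h" "bounded S"
  obtains B where "0 \<le> B" "\<And>x. x \<in> S \<Longrightarrow> norm (h x) \<le> B"
proof -
  have "compact (h ` closure S)"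
    using assms by (intro compact_continuous_image) (auto intro: continuous_on_subset)
  then obtain B where "\<And>x. x \<in> closure S \<Longrightarrow> norm (h x) \<le> B"
    by (metis bounded_iff compact_imp_bounded image_eqI)
  then show ?thesis using closure_subset[of S]
    by (intro that[of "max B 0"]) (auto simp: le_max_iff_disj)
qed

lemma L2_on_continuous:
  fixes h :: "'a::euclidean_space \<Rightarrow> 'b::euclidean_space"
  assumes S: "open S" "bounded S" and h: "continuous_on UNIV h"
  shows "L2_on S h"
  unfolding L2_on_def
proof
  show m: "h \<in> borel_measurable (lebesgue_on S)"
    using borel_measurable_continuous_onI[OF h] by (rule borel_measurable_lebesgue_on)
  interpret finite_measure "lebesgue_on S" using S by (rule finite_measure_bounded_open)
  obtain B where B: "0 \<le> B" "\<And>x. x \<in> S \<Longrightarrow> norm (h x) \<le> B"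
    using bounded_image_continuous[OF h S(2)] by blast
  show "integrable (lebesgue_on S) (\<lambda>x. (norm (h x))\<^sup>2)"
  proof (rule integrable_const_bound[of _ "B\<^sup>2"])
    show "AE x in lebesgue_on S. norm ((norm (h x))\<^sup>2) \<le> B\<^sup>2"
      using B by (intro AE_I2) (auto intro: power_mono)
  qed (use m in measurable)
qed

lemma test_function_gradient_continuous:
  fixes \<psi> :: "'a::euclidean_space \<Rightarrow> real"
  assumes "test_function S \<psi>" "\<And>x. GDERIV \<psi> x :> D x"
  shows "continuous_on UNIV D"
proof (subst continuous_on_componentwise, intro ballI)
  fix b :: 'a
  have "Ck_on (Suc 0) \<psi> UNIV" using assms(1) by (simp only: test_function_def smooth_on_def)
  then have "continuous_on UNIV (\<lambda>x. frechet_derivative \<psi> (at x) b)" by simp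
  also have "(\<lambda>x. frechet_derivative \<psi> (at x) b) = (\<lambda>x. D x \<bullet> b)"
  proof
    fix x
    have "frechet_derivative \<psi> (at x) = (\<lambda>y. y \<bullet> D x)"
      using assms(2)[of x] frechet_derivative_at unfolding gderiv_def by metis
    then show "frechet_derivative \<psi> (at x) b = D x \<bullet> b" by (simp add: inner_commute)
  qed
  finally show "continuous_on UNIV (\<lambda>x. D x \<bullet> b)" .
qed

text \<open>If \<open>\<psi>\<close> is a test function then \<open>v \<psi>\<close> is continuously differentiable with compact support, so the
  integral of its gradient vanishes.\<close>

lemma has_weak_gradient_C1:
  fixes v :: "'a::euclidean_space \<Rightarrow> real"
  assumes S: "open S" "bounded S"
    and v: "\<And>x. GDERIV v x :> Dv x" "continuous_on UNIV Dv"
  shows "has_weak_gradient S v Dv"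
  unfolding has_weak_gradient_def
proof (intro conjI allI impI)
  have contv: "continuous_on UNIV v" using v(1) by (rule GDERIV_continuous_on)
  show "L2_on S v" "L2_on S Dv" using L2_on_continuous[OF S] contv v(2) by auto
  fix \<psi> D assume "test_function S \<psi> \<and> (\<forall>x. GDERIV \<psi> x :> D x)"
  then have tf: "test_function S \<psi>" and D: "\<And>x. GDERIV \<psi> x :> D x" by auto
  have cont\<psi>: "continuous_on UNIV \<psi>" using D by (rule GDERIV_continuous_on)
  have contD: "continuous_on UNIV D" using tf D by (rule test_function_gradient_continuous)
  define K where "K = closure {x. \<psi> x \<noteq> 0}"
  have K: "compact K" "K \<subseteq> S" using tf by (auto simp: test_function_def K_def)
  have \<psi>0: "\<psi> x = 0" if "x \<notin> K" for x using that closure_subset[of "{x. \<psi> x \<noteq> 0}"] by (auto simp: K_def)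
  have D0: "D x = 0" if "x \<notin> K" for x
    using GDERIV_support[OF D compact_imp_closed[OF K(1)] \<psi>0 that] .
  have c1: "continuous_on UNIV (\<lambda>x. v x *\<^sub>R D x)" and c2: "continuous_on UNIV (\<lambda>x. \<psi> x *\<^sub>R Dv x)"
    using contv contD cont\<psi> v(2) by (auto intro: continuous_on_scaleR)
  have i1: "integrable lborel (\<lambda>x. v x *\<^sub>R D x)" and i2: "integrable lborel (\<lambda>x. \<psi> x *\<^sub>R Dv x)"
    using c1 c2 K(1) \<psi>0 D0 by (auto intro!: integrable_lborel_compact_support)
  have "integral\<^sup>L lborel (\<lambda>x. v x *\<^sub>R D x + \<psi> x *\<^sub>R Dv x) = 0"
  proof (rule integral_gradient_compact_support[OF _ _ K(1)])
    show "GDERIV (\<lambda>x. v x * \<psi> x) x :> v x *\<^sub>R D x + \<psi> x *\<^sub>R Dv x" for x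
      by (rule GDERIV_mult[OF v(1) D])
    show "continuous_on UNIV (\<lambda>x. v x *\<^sub>R D x + \<psi> x *\<^sub>R Dv x)"
      using c1 c2 by (rule continuous_on_add)
  qed (use \<psi>0 in auto)
  then have sum0: "integral\<^sup>L lborel (\<lambda>x. v x *\<^sub>R D x) + integral\<^sup>L lborel (\<lambda>x. \<psi> x *\<^sub>R Dv x) = 0"
    using i1 i2 by simp
  have S': "S \<in> sets lebesgue" using S(1) by (simp add: borel_open)
  have "integral\<^sup>L (lebesgue_on S) (\<lambda>x. v x *\<^sub>R D x) = integral\<^sup>L lborel (\<lambda>x. v x *\<^sub>R D x)"
    using S' K(2) D0 by (intro integral_lebesgue_on_eq_lborel borel_measurable_continuous_onI c1) auto
  moreover have "integral\<^sup>L (lebesgue_on S) (\<lambda>x. \<psi> x *\<^sub>R Dv x) = integral\<^sup>L lborel (\<lambda>x. \<psi> x *\<^sub>R Dv x)"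
    using S' K(2) \<psi>0 by (intro integral_lebesgue_on_eq_lborel borel_measurable_continuous_onI c2) auto
  ultimately show "integral\<^sup>L (lebesgue_on S) (\<lambda>x. v x *\<^sub>R D x) =
      - integral\<^sup>L (lebesgue_on S) (\<lambda>x. \<psi> x *\<^sub>R Dv x)"
    using sum0 by (simp add: add_eq_0_iff)
qed

lemma cyl_open_bounded:
  assumes "open \<omega>" "bounded \<omega>"
  shows "open (cyl \<omega>)" "bounded (cyl \<omega>)"
  using assms by (auto simp: cyl_def intro: open_Times bounded_Times)

text \<open>These functions are smooth enough to serve as their own approximants in the definition of the
  trace, so their trace on the top face is the constant \<open>\<phi> 1\<close>.\<close>

lemma vertical_test_function:
  fixes \<omega> :: "'a::euclidean_space set" and \<phi> \<phi>' :: "real \<Rightarrow> real"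
  assumes \<omega>: "open \<omega>" "bounded \<omega>"
    and \<phi>: "\<And>t. (\<phi> has_real_derivative \<phi>' t) (at t)" "continuous_on UNIV \<phi>'" "\<phi> 1 = 0"
  shows "(\<lambda>x. \<phi> (snd x)) \<in> H10_xN \<omega>"
    and "has_weak_gradient (cyl \<omega>) (\<lambda>x. \<phi> (snd x)) (\<lambda>x. (0, \<phi>' (snd x)))"
proof -
  let ?v = "\<lambda>x :: 'a \<times> real. \<phi> (snd x)" and ?D = "\<lambda>x :: 'a \<times> real. (0 :: 'a, \<phi>' (snd x))"
  note S = cyl_open_bounded[OF \<omega>]
  have D: "GDERIV ?v x :> ?D x" for x
  proof -
    have "((\<lambda>x. \<phi> (snd x)) has_derivative (\<lambda>h. \<phi>' (snd x) * snd h)) (at x)"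
      by (rule has_derivative_compose[OF has_derivative_snd[OF has_derivative_ident],
            of \<phi> "\<lambda>h. \<phi>' (snd x) * h"]) (use \<phi>(1) in \<open>simp add: has_field_derivative_def\<close>)
    moreover have "(\<lambda>h. \<phi>' (snd x) * snd h) = (\<lambda>h :: 'a \<times> real. h \<bullet> ?D x)"
      by (auto simp: inner_prod_def)
    ultimately show ?thesis by (simp add: gderiv_def)
  qed
  have contD: "continuous_on UNIV ?D"
    by (intro continuous_on_Pair continuous_on_const continuous_on_compose2[OF \<phi>(2)]
        continuous_on_snd continuous_on_id) auto
  have contv: "continuous_on UNIV ?v" using D by (rule GDERIV_continuous_on)
  show wg: "has_weak_gradient (cyl \<omega>) ?v ?D"
    using S D contD by (rule has_weak_gradient_C1)
  have "L2_on (cyl \<omega>) ?v" "L2_on (cyl \<omega>) ?D" using L2_on_continuous[OF S] contv contD by auto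
  moreover have "L2_on \<omega> (\<lambda>_. 0 :: real)" using \<omega> by (intro L2_on_continuous) auto
  ultimately have "has_trace \<omega> ?v (\<lambda>_. 0)"
    unfolding has_trace_def L2_tendsto_def using wg D contD \<phi>(3)
    by (intro exI[of _ ?D] exI[of _ "\<lambda>_. ?v"] exI[of _ "\<lambda>_. ?D"]) auto
  then show "?v \<in> H10_xN \<omega>"
    using wg by (auto simp: H10_xN_def H10_def H1_def)
qed

section \<open>Vertical integration in the cylinder\<close>

lemma L2_on_integrable_inner:
  fixes u :: "'a::euclidean_space \<Rightarrow> 'b::euclidean_space"
  assumes S: "open S" "bounded S" and u: "L2_on S u"
    and b: "b \<in> borel_measurable borel" "\<And>x. x \<in> S \<Longrightarrow> norm (b x) \<le> B"
  shows "integrable (lebesgue_on S) (\<lambda>x. u x \<bullet> b x)"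
proof -
  interpret finite_measure "lebesgue_on S" using S by (rule finite_measure_bounded_open)
  have [measurable]: "u \<in> borel_measurable (lebesgue_on S)" "b \<in> borel_measurable (lebesgue_on S)"
    using u borel_measurable_lebesgue_on[OF b(1)] by (auto simp: L2_on_def)
  show ?thesis
  proof (rule Bochner_Integration.integrable_bound)
    show "integrable (lebesgue_on S) (\<lambda>x. \<bar>B\<bar> * (1 + (norm (u x))\<^sup>2))"
      using u by (simp add: L2_on_def)
    show "AE x in lebesgue_on S. norm (u x \<bullet> b x) \<le> norm (\<bar>B\<bar> * (1 + (norm (u x))\<^sup>2))"
    proof (rule AE_I2)
      fix x assume "x \<in> space (lebesgue_on S)"
      then have "norm (b x) \<le> \<bar>B\<bar>" using b(2)[of x] by auto
      have "norm (u x \<bullet> b x) \<le> norm (u x) * norm (b x)" by (simp add: Cauchy_Schwarz_ineq2)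
      also have "\<dots> \<le> (1 + (norm (u x))\<^sup>2) * \<bar>B\<bar>"
      proof (rule mult_mono)
        have "0 \<le> (norm (u x) - 1)\<^sup>2" by simp
        then show "norm (u x) \<le> 1 + (norm (u x))\<^sup>2"
          using norm_ge_zero[of "u x"] unfolding power2_diff one_power2 by linarith
      qed (use \<open>norm (b x) \<le> \<bar>B\<bar>\<close> in auto)
      finally show "norm (u x \<bullet> b x) \<le> norm (\<bar>B\<bar> * (1 + (norm (u x))\<^sup>2))"
        by (simp add: abs_mult mult.commute)
    qed
  qed measurable
qed

lemma L2_on_diff:
  fixes u v :: "'a::euclidean_space \<Rightarrow> 'b::euclidean_space"
  assumes u: "L2_on S u" and v: "L2_on S v"
  shows "L2_on S (\<lambda>x. u x - v x)"
  unfolding L2_on_def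
proof
  have [measurable]: "u \<in> borel_measurable (lebesgue_on S)" "v \<in> borel_measurable (lebesgue_on S)"
    using u v by (auto simp: L2_on_def)
  show "(\<lambda>x. u x - v x) \<in> borel_measurable (lebesgue_on S)" by measurable
  show "integrable (lebesgue_on S) (\<lambda>x. (norm (u x - v x))\<^sup>2)"
  proof (rule Bochner_Integration.integrable_bound)
    show "integrable (lebesgue_on S) (\<lambda>x. 2 * (norm (u x))\<^sup>2 + 2 * (norm (v x))\<^sup>2)"
      using u v by (simp add: L2_on_def)
    show "AE x in lebesgue_on S. norm ((norm (u x - v x))\<^sup>2) \<le> norm (2 * (norm (u x))\<^sup>2 + 2 * (norm (v x))\<^sup>2)"
    proof (rule AE_I2)
      fix x
      have "(norm (u x - v x))\<^sup>2 \<le> (norm (u x) + norm (v x))\<^sup>2"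
        by (intro power_mono norm_triangle_ineq4) simp
      also have "\<dots> \<le> 2 * (norm (u x))\<^sup>2 + 2 * (norm (v x))\<^sup>2"
        using sum_squares_bound[of "norm (u x)" "norm (v x)"] by (simp add: power2_sum)
      finally show "norm ((norm (u x - v x))\<^sup>2) \<le> norm (2 * (norm (u x))\<^sup>2 + 2 * (norm (v x))\<^sup>2)" by simp
    qed
  qed measurable
qed

text \<open>Convergence in \<open>L\<^sup>2\<close> over a set of finite measure implies convergence in \<open>L\<^sup>1\<close>, here through the
  elementary bound \<open>a \<le> \<delta> + a\<^sup>2 / \<delta>\<close>.\<close>

lemma L2_tendsto_integral:
  fixes u :: "'a::euclidean_space \<Rightarrow> 'b::euclidean_space"
  assumes S: "open S" "bounded S" and u: "L2_tendsto S \<phi> u"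
    and b: "b \<in> borel_measurable borel" "\<And>x. x \<in> S \<Longrightarrow> norm (b x) \<le> B"
  shows "(\<lambda>n. integral\<^sup>L (lebesgue_on S) (\<lambda>x. \<phi> n x \<bullet> b x)) \<longlonglongrightarrow> integral\<^sup>L (lebesgue_on S) (\<lambda>x. u x \<bullet> b x)"
proof (rule tendstoI)
  let ?M = "lebesgue_on S"
  fix e :: real assume e: "0 < e"
  interpret finite_measure ?M using S by (rule finite_measure_bounded_open)
  have L2: "L2_on S (\<phi> n)" "L2_on S u" for n using u by (auto simp: L2_tendsto_def)
  \<comment> \<open>With this \<open>\<delta>\<close> the bound \<open>\<bar>B\<bar> (\<delta> \<mu>(S) + \<delta>)\<close> obtained below stays under \<open>e\<close>.\<close>
  define \<delta> where "\<delta> = e / ((\<bar>B\<bar> + 1) * (measure ?M (space ?M) + 1))"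
  have m: "0 \<le> measure ?M (space ?M)" by simp
  then have \<delta>: "0 < \<delta>" using e by (simp add: \<delta>_def add_nonneg_pos)
  have "\<forall>\<^sub>F n in sequentially. integral\<^sup>L ?M (\<lambda>x. (norm (\<phi> n x - u x))\<^sup>2) < \<delta>\<^sup>2"
    using u \<delta> by (intro order_tendstoD) (auto simp: L2_tendsto_def)
  then show "\<forall>\<^sub>F n in sequentially. dist (integral\<^sup>L ?M (\<lambda>x. \<phi> n x \<bullet> b x)) (integral\<^sup>L ?M (\<lambda>x. u x \<bullet> b x)) < e"
  proof eventually_elim
    case (elim n)
    have d: "L2_on S (\<lambda>x. \<phi> n x - u x)" using L2 by (rule L2_on_diff)
    have int2: "integrable ?M (\<lambda>x. (norm (\<phi> n x - u x))\<^sup>2)" using d by (simp add: L2_on_def)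
    have "integral\<^sup>L ?M (\<lambda>x. \<phi> n x \<bullet> b x) - integral\<^sup>L ?M (\<lambda>x. u x \<bullet> b x)
        = integral\<^sup>L ?M (\<lambda>x. (\<phi> n x - u x) \<bullet> b x)"
      using L2_on_integrable_inner[OF S L2(1) b] L2_on_integrable_inner[OF S L2(2) b]
      by (simp add: inner_diff_left)
    also have "\<bar>\<dots>\<bar> \<le> integral\<^sup>L ?M (\<lambda>x. \<bar>B\<bar> * (\<delta> + (norm (\<phi> n x - u x))\<^sup>2 / \<delta>))"
    proof (rule integral_abs_bound_integral)
      show "integrable ?M (\<lambda>x. (\<phi> n x - u x) \<bullet> b x)" by (rule L2_on_integrable_inner[OF S d b])
      show "integrable ?M (\<lambda>x. \<bar>B\<bar> * (\<delta> + (norm (\<phi> n x - u x))\<^sup>2 / \<delta>))" using int2 by simp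
      fix x assume "x \<in> space ?M"
      then have bx: "norm (b x) \<le> \<bar>B\<bar>" using b(2)[of x] by auto
      have "\<bar>(\<phi> n x - u x) \<bullet> b x\<bar> \<le> norm (\<phi> n x - u x) * norm (b x)" by (rule Cauchy_Schwarz_ineq2)
      also have "\<dots> \<le> (\<delta> + (norm (\<phi> n x - u x))\<^sup>2 / \<delta>) * \<bar>B\<bar>"
      proof (rule mult_mono[OF _ bx])
        define a where "a = norm (\<phi> n x - u x)"
        have "0 \<le> a" by (simp add: a_def)
        have "\<delta> * a \<le> \<delta> * \<delta> + a * a"
        proof (cases "a \<le> \<delta>")
          case True
          then have "\<delta> * a \<le> \<delta> * \<delta>" using \<delta> by simp
          then show ?thesis by (simp add: add_increasing2)
        next
          case False
          then have "\<delta> * a \<le> a * a" using \<open>0 \<le> a\<close> by (intro mult_right_mono) auto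
          then show ?thesis using \<delta> by (simp add: add_increasing)
        qed
        then have "a \<le> \<delta> + a\<^sup>2 / \<delta>" using \<delta> by (simp add: field_simps power2_eq_square)
        then show "norm (\<phi> n x - u x) \<le> \<delta> + (norm (\<phi> n x - u x))\<^sup>2 / \<delta>" by (simp add: a_def)
      qed (use \<delta> in auto)
      finally show "\<bar>(\<phi> n x - u x) \<bullet> b x\<bar> \<le> \<bar>B\<bar> * (\<delta> + (norm (\<phi> n x - u x))\<^sup>2 / \<delta>)"
        by (simp add: mult.commute)
    qed
    also have "\<dots> = \<bar>B\<bar> * (\<delta> * measure ?M (space ?M) + integral\<^sup>L ?M (\<lambda>x. (norm (\<phi> n x - u x))\<^sup>2) / \<delta>)"
      using int2 by simp
    also have "\<dots> \<le> \<bar>B\<bar> * (\<delta> * measure ?M (space ?M) + \<delta>)"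
    proof (intro mult_left_mono add_left_mono)
      have "integral\<^sup>L ?M (\<lambda>x. (norm (\<phi> n x - u x))\<^sup>2) / \<delta> \<le> \<delta>\<^sup>2 / \<delta>"
        using elim \<delta> by (intro divide_right_mono) auto
      then show "integral\<^sup>L ?M (\<lambda>x. (norm (\<phi> n x - u x))\<^sup>2) / \<delta> \<le> \<delta>"
        using \<delta> by (simp add: power2_eq_square)
    qed simp
    also have "\<dots> < (\<bar>B\<bar> + 1) * (\<delta> * (measure ?M (space ?M) + 1))"
    proof -
      have "0 < \<delta> * (measure ?M (space ?M) + 1)" using \<delta> m by (intro mult_pos_pos) linarith+
      then show ?thesis by (simp add: distrib_right distrib_left)
    qed
    also have "\<dots> = e"
      using m by (simp add: \<delta>_def add_nonneg_eq_0_iff)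
    finally show ?case by (simp add: dist_real_def)
  qed
qed

lemma integral_cyl_fubini:
  fixes F :: "'a::euclidean_space \<times> real \<Rightarrow> real"
  assumes \<omega>: "open \<omega>" and F: "F \<in> borel_measurable borel"
    and int: "integrable (lebesgue_on (cyl \<omega>)) F"
  shows "integral\<^sup>L (lebesgue_on (cyl \<omega>)) F
     = integral\<^sup>L (lebesgue_on \<omega>) (\<lambda>x. integral\<^sup>L lborel (\<lambda>t. indicator {0<..<1} t * F (x, t)))"
proof -
  have c: "cyl \<omega> \<in> sets borel" using \<omega> unfolding cyl_def by (intro borel_open open_Times) auto
  have [measurable]: "\<omega> \<in> sets borel" using \<omega> by auto
  define F0 where "F0 x = indicator (cyl \<omega>) x * F x" for x
  have F0m: "F0 \<in> borel_measurable borel" unfolding F0_def using F c by measurable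
  have "integrable lebesgue F0"
    using int c by (subst (asm) integrable_restrict_space) (auto simp: F0_def[abs_def])
  then have int0: "integrable (lborel \<Otimes>\<^sub>M lborel) F0"
    using F0m by (simp add: integrable_completion lborel_prod)
  have "integral\<^sup>L (lebesgue_on (cyl \<omega>)) F = integral\<^sup>L lebesgue F0"
    using c by (subst integral_restrict_space) (auto simp: F0_def[abs_def])
  also have "\<dots> = integral\<^sup>L lborel F0" using F0m by (intro integral_completion) simp
  also have "\<dots> = integral\<^sup>L (lborel \<Otimes>\<^sub>M lborel) F0" by (simp add: lborel_prod)
  also have "\<dots> = integral\<^sup>L lborel (\<lambda>x. integral\<^sup>L lborel (\<lambda>t. F0 (x, t)))"
    using lborel_pair.integral_fst'[OF int0] by simp
  also have "\<dots> = integral\<^sup>L lborel (\<lambda>x. indicator \<omega> x *\<^sub>R integral\<^sup>L lborel (\<lambda>t. indicator {0<..<1} t * F (x, t)))"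
    by (intro Bochner_Integration.integral_cong refl) (auto simp: F0_def cyl_def indicator_def)
  also have "\<dots> = integral\<^sup>L lebesgue (\<lambda>x. indicator \<omega> x *\<^sub>R integral\<^sup>L lborel (\<lambda>t. indicator {0<..<1} t * F (x, t)))"
  proof (rule integral_completion[symmetric])
    have "F \<in> borel_measurable (lborel \<Otimes>\<^sub>M lborel)" using F by (simp add: lborel_prod)
    then have "(\<lambda>x. integral\<^sup>L lborel (\<lambda>t. indicator {0<..<1} t * F (x, t))) \<in> borel_measurable lborel"
      by measurable
    then show "(\<lambda>x. indicator \<omega> x *\<^sub>R integral\<^sup>L lborel (\<lambda>t. indicator {0<..<1} t * F (x, t)))
        \<in> borel_measurable lborel" by measurable
  qed
  also have "\<dots> = integral\<^sup>L (lebesgue_on \<omega>) (\<lambda>x. integral\<^sup>L lborel (\<lambda>t. indicator {0<..<1} t * F (x, t)))"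
    by (rule integral_restrict_space[symmetric]) auto
  finally show ?thesis .
qed

lemma integral_cyl_vertical:
  fixes \<omega> :: "'a::euclidean_space set"
  assumes \<omega>: "open \<omega>" and h: "h \<in> borel_measurable borel"
    and int: "integrable (lebesgue_on (cyl \<omega>)) (\<lambda>x. h (snd x))"
  shows "integral\<^sup>L (lebesgue_on (cyl \<omega>)) (\<lambda>x. h (snd x))
     = measure lebesgue \<omega> * integral\<^sup>L lborel (\<lambda>t. indicator {0<..<1} t * h t)"
proof -
  have m: "(\<lambda>x :: 'a \<times> real. h (snd x)) \<in> borel_measurable borel"
    using h by (simp add: borel_prod[symmetric])
  show ?thesis
    using integral_cyl_fubini[OF \<omega> m int] \<omega> by (simp add: measure_restrict_space)
qed

lemma vertical_integration_by_parts_C1: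
  fixes \<omega> :: "'a::euclidean_space set" and \<theta> \<theta>' :: "real \<Rightarrow> real"
  assumes \<omega>: "open \<omega>" "bounded \<omega>"
    and \<Phi>: "\<And>x. GDERIV \<Phi> x :> D x" "continuous_on UNIV D"
    and \<theta>: "\<And>t. (\<theta> has_real_derivative \<theta>' t) (at t)" "continuous_on UNIV \<theta>'" "\<theta> 0 = 0"
  shows "integral\<^sup>L (lebesgue_on (cyl \<omega>)) (\<lambda>x. D x \<bullet> (0, \<theta> (snd x)))
      + integral\<^sup>L (lebesgue_on (cyl \<omega>)) (\<lambda>x. \<Phi> x \<bullet> \<theta>' (snd x))
     = integral\<^sup>L (lebesgue_on \<omega>) (\<lambda>x. \<Phi> (x, 1) \<bullet> \<theta> 1)"
proof -
  note S = cyl_open_bounded[OF \<omega>]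
  have cont\<theta>: "continuous_on A \<theta>" for A using \<theta>(1) by (rule DERIV_everywhere_continuous)
  have cont\<Phi>: "continuous_on A \<Phi>" for A using \<Phi>(1) by (rule GDERIV_continuous_on)
  define F1 where "F1 = (\<lambda>x. D x \<bullet> (0, \<theta> (snd x)))"
  define F2 where "F2 = (\<lambda>x :: 'a \<times> real. \<Phi> x \<bullet> \<theta>' (snd x))"
  have c: "continuous_on UNIV F1" "continuous_on UNIV F2"
    unfolding F1_def F2_def
    by (intro continuous_intros \<Phi>(2) cont\<Phi> continuous_on_compose2[OF \<theta>(2)]
        continuous_on_compose2[OF cont\<theta>[of UNIV]] subset_UNIV)+
  have int: "integrable (lebesgue_on (cyl \<omega>)) F" if "continuous_on UNIV F" for F :: "'a \<times> real \<Rightarrow> real"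
    using L2_on_integrable_inner[OF S L2_on_continuous[OF S that], of "\<lambda>_. 1" 1] by simp
  have "integral\<^sup>L (lebesgue_on (cyl \<omega>)) F1 + integral\<^sup>L (lebesgue_on (cyl \<omega>)) F2
      = integral\<^sup>L (lebesgue_on (cyl \<omega>)) (\<lambda>x. F1 x + F2 x)"
    using int c by simp
  also have "\<dots> = integral\<^sup>L (lebesgue_on \<omega>)
      (\<lambda>x. integral\<^sup>L lborel (\<lambda>t. indicator {0<..<1} t * (F1 (x, t) + F2 (x, t))))"
    by (intro integral_cyl_fubini[OF \<omega>(1)] int borel_measurable_continuous_onI continuous_on_add c)
  also have "\<dots> = integral\<^sup>L (lebesgue_on \<omega>) (\<lambda>x. \<Phi> (x, 1) * \<theta> 1)"
  proof (rule Bochner_Integration.integral_cong)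
    fix x :: 'a
    have "integral\<^sup>L lborel (\<lambda>t. indicator {0<..<1} t * (F1 (x, t) + F2 (x, t)))
        = \<Phi> (x, 1) * \<theta> 1 - \<Phi> (x, 0) * \<theta> 0"
    proof (rule integral_Ioo_FTC[where F = "\<lambda>t. \<Phi> (x, t) * \<theta> t"])
      fix t
      have "((\<lambda>t. \<Phi> (x, t)) has_derivative (\<lambda>s. (0, s) \<bullet> D (x, t))) (at t)"
        by (rule has_derivative_compose[of "\<lambda>t. (x, t)" "\<lambda>s. (0, s)" t UNIV \<Phi> "\<lambda>y. y \<bullet> D (x, t)"])
           (use \<Phi>(1)[of "(x, t)"] in \<open>auto simp: gderiv_def intro!: derivative_eq_intros\<close>)
      then have "((\<lambda>t. \<Phi> (x, t)) has_real_derivative snd (D (x, t))) (at t)"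
        by (simp add: has_field_derivative_def inner_prod_def mult_commute_abs)
      from DERIV_mult[OF this \<theta>(1)]
      show "((\<lambda>t. \<Phi> (x, t) * \<theta> t) has_real_derivative F1 (x, t) + F2 (x, t)) (at t)"
        by (simp add: F1_def F2_def inner_prod_def algebra_simps)
    next
      show "continuous_on {0..1} (\<lambda>t. F1 (x, t) + F2 (x, t))"
        by (intro continuous_intros continuous_on_compose2[OF c(1)] continuous_on_compose2[OF c(2)] subset_UNIV)
    qed simp
    then show "integral\<^sup>L lborel (\<lambda>t. indicator {0<..<1} t * (F1 (x, t) + F2 (x, t))) = \<Phi> (x, 1) * \<theta> 1"
      using \<theta>(3) by simp
  qed simp
  finally show ?thesis by (simp add: F1_def F2_def)
qed

text \<open>Integration by parts in the vertical direction
  holds for the \<open>C\<^sup>1\<close> functions that approximate \<open>z\<close> in the definition of its trace, with a boundary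
  term on the top face that vanishes in the limit; the condition \<open>\<theta> 0 = 0\<close> removes the one on the
  bottom face.\<close>

lemma zero_trace_integration_by_parts:
  fixes \<omega> :: "'a::euclidean_space set" and z :: "'a \<times> real \<Rightarrow> real"
  assumes \<omega>: "open \<omega>" "bounded \<omega>" and z: "has_trace \<omega> z (\<lambda>_. 0)"
  obtains G where "has_weak_gradient (cyl \<omega>) z G"
    "\<And>\<theta> \<theta>'. (\<And>t. (\<theta> has_real_derivative \<theta>' t) (at t)) \<Longrightarrow> continuous_on UNIV \<theta>' \<Longrightarrow> \<theta> 0 = 0 \<Longrightarrow>
      integral\<^sup>L (lebesgue_on (cyl \<omega>)) (\<lambda>x. G x \<bullet> (0, \<theta> (snd x)))
      = - integral\<^sup>L (lebesgue_on (cyl \<omega>)) (\<lambda>x. z x * \<theta>' (snd x))"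
proof -
  note S = cyl_open_bounded[OF \<omega>]
  obtain G \<Phi> D where G: "has_weak_gradient (cyl \<omega>) z G"
    and \<Phi>: "\<And>n x. GDERIV (\<Phi> n) x :> D n x" "\<And>n. continuous_on UNIV (D n)"
    and lim: "L2_tendsto (cyl \<omega>) \<Phi> z" "L2_tendsto (cyl \<omega>) D G" "L2_tendsto \<omega> (\<lambda>n x'. \<Phi> n (x', 1)) (\<lambda>_. 0)"
    using z unfolding has_trace_def by blast
  show ?thesis
  proof (rule that[OF G])
    fix \<theta> \<theta>' :: "real \<Rightarrow> real"
    assume \<theta>: "\<And>t. (\<theta> has_real_derivative \<theta>' t) (at t)" "continuous_on UNIV \<theta>'" "\<theta> 0 = 0"
    have cont\<theta>: "continuous_on UNIV \<theta>" using \<theta>(1) by (rule DERIV_everywhere_continuous)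
    have c1: "continuous_on UNIV (\<lambda>x :: 'a \<times> real. (0 :: 'a, \<theta> (snd x)))"
      by (intro continuous_intros continuous_on_compose2[OF cont\<theta>] subset_UNIV)
    have c2: "continuous_on UNIV (\<lambda>x :: 'a \<times> real. \<theta>' (snd x))"
      by (intro continuous_intros continuous_on_compose2[OF \<theta>(2)] subset_UNIV)
    obtain B1 where B1: "\<And>x. x \<in> cyl \<omega> \<Longrightarrow> norm (0 :: 'a, \<theta> (snd x)) \<le> B1"
      using bounded_image_continuous[OF c1 S(2)] by blast
    obtain B2 where B2: "\<And>x. x \<in> cyl \<omega> \<Longrightarrow> norm (\<theta>' (snd x)) \<le> B2"
      using bounded_image_continuous[OF c2 S(2)] by blast
    have "(\<lambda>n. integral\<^sup>L (lebesgue_on (cyl \<omega>)) (\<lambda>x. D n x \<bullet> (0, \<theta> (snd x)))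
          + integral\<^sup>L (lebesgue_on (cyl \<omega>)) (\<lambda>x. \<Phi> n x \<bullet> \<theta>' (snd x)))
      \<longlonglongrightarrow> integral\<^sup>L (lebesgue_on (cyl \<omega>)) (\<lambda>x. G x \<bullet> (0, \<theta> (snd x)))
          + integral\<^sup>L (lebesgue_on (cyl \<omega>)) (\<lambda>x. z x \<bullet> \<theta>' (snd x))"
      using B1 B2 c1 c2
      by (intro tendsto_add L2_tendsto_integral[OF S lim(1)] L2_tendsto_integral[OF S lim(2)]
          borel_measurable_continuous_onI)
    moreover have "(\<lambda>n. integral\<^sup>L (lebesgue_on \<omega>) (\<lambda>x. \<Phi> n (x, 1) \<bullet> \<theta> 1))
        \<longlonglongrightarrow> integral\<^sup>L (lebesgue_on \<omega>) (\<lambda>x. 0 \<bullet> \<theta> 1)"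
      by (intro L2_tendsto_integral[OF \<omega> lim(3)]) auto
    ultimately have "integral\<^sup>L (lebesgue_on (cyl \<omega>)) (\<lambda>x. G x \<bullet> (0, \<theta> (snd x)))
          + integral\<^sup>L (lebesgue_on (cyl \<omega>)) (\<lambda>x. z x \<bullet> \<theta>' (snd x))
        = integral\<^sup>L (lebesgue_on \<omega>) (\<lambda>x. 0 \<bullet> \<theta> 1)"
      unfolding vertical_integration_by_parts_C1[OF \<omega> \<Phi> \<theta>] by (rule LIMSEQ_unique)
    then show "integral\<^sup>L (lebesgue_on (cyl \<omega>)) (\<lambda>x. G x \<bullet> (0, \<theta> (snd x)))
      = - integral\<^sup>L (lebesgue_on (cyl \<omega>)) (\<lambda>x. z x * \<theta>' (snd x))" by simp
  qed
qed

lemma AE_lborel_vertical: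
  assumes "AE t in lborel. P (t :: real)"
  shows "AE x in (lborel :: ('a::euclidean_space \<times> real) measure). P (snd x)"
proof -
  obtain N where N: "{t. \<not> P t} \<subseteq> N" "emeasure lborel N = 0" "N \<in> sets lborel"
    using assms by (auto elim: AE_E)
  have "emeasure (lborel \<Otimes>\<^sub>M lborel) ((UNIV :: 'a set) \<times> N) = 0"
    using N by (subst lborel.emeasure_pair_measure_Times) auto
  then have "UNIV \<times> N \<in> null_sets (lborel \<Otimes>\<^sub>M lborel :: ('a \<times> real) measure)"
    using N by (intro null_setsI) auto
  then have "(UNIV :: 'a set) \<times> N \<in> null_sets lborel" by (simp only: lborel_prod)
  then show ?thesis by (rule AE_I') (use N in auto)
qed

text \<open>By Fubini's theorem almost every vertical section of a Borel version of \<open>z\<close> is integrable and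
  coincides almost everywhere with \<open>\<zeta>\<close>; any such section is the desired representative.\<close>

lemma vertical_representative:
  fixes \<omega> :: "'a::euclidean_space set" and z :: "'a \<times> real \<Rightarrow> real"
  assumes \<omega>: "open \<omega>" "bounded \<omega>" "\<omega> \<noteq> {}" and z: "L2_on (cyl \<omega>) z"
    and \<zeta>: "AE x in lebesgue_on (cyl \<omega>). z x = \<zeta> (snd x)"
  obtains \<zeta>' where "\<zeta>' \<in> borel_measurable borel"
    "integrable lborel (\<lambda>t. indicator {0<..<1} t * \<zeta>' t)"
    "AE x in lebesgue_on (cyl \<omega>). z x = \<zeta>' (snd x)"
proof -
  note S = cyl_open_bounded[OF \<omega>(1,2)]
  have c: "cyl \<omega> \<in> sets lebesgue" using S(1) by (simp add: borel_open)
  have "integrable (lebesgue_on (cyl \<omega>)) (\<lambda>x. z x \<bullet> 1)"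
    by (rule L2_on_integrable_inner[OF S z, of _ 1]) auto
  then have intz: "integrable lebesgue (\<lambda>x. indicator (cyl \<omega>) x * z x)"
    using c by (subst (asm) integrable_restrict_space) auto
  obtain z0 where z0: "z0 \<in> borel_measurable lborel"
    and z0_eq: "AE x in lborel. indicator (cyl \<omega>) x * z x = z0 x"
    using completion_ex_borel_measurable_real[OF borel_measurable_integrable[OF intz]] by blast
  have "integrable lebesgue z0"
  proof (rule Bochner_Integration.integrable_cong_AE_imp[OF intz])
    show "z0 \<in> borel_measurable lebesgue" using z0 by (rule measurable_completion)
    show "AE x in lebesgue. indicator (cyl \<omega>) x * z x = z0 x" using z0_eq by (rule AE_completion)
  qed
  then have int0: "integrable (lborel \<Otimes>\<^sub>M lborel) z0"
    using z0 by (simp add: integrable_completion lborel_prod)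
  have "AE x in lebesgue. x \<in> cyl \<omega> \<longrightarrow> z x = \<zeta> (snd x)"
    using \<zeta> c by (simp add: AE_restrict_space_iff)
  then have "AE x in lborel. x \<in> cyl \<omega> \<longrightarrow> z x = \<zeta> (snd x)" by (simp only: AE_completion_iff)
  with z0_eq have "AE x in lborel. x \<in> cyl \<omega> \<longrightarrow> z0 x = \<zeta> (snd x)"
    by eventually_elim auto
  then have "AE x in lborel \<Otimes>\<^sub>M lborel. x \<in> cyl \<omega> \<longrightarrow> z0 x = \<zeta> (snd x)" by (simp only: lborel_prod)
  then have sections: "AE x in lborel. AE t in lborel. (x, t) \<in> cyl \<omega> \<longrightarrow> z0 (x, t) = \<zeta> t"
    using lborel_pair.AE_pair by fastforce
  have "\<exists>x\<in>\<omega>. (AE t in lborel. (x, t) \<in> cyl \<omega> \<longrightarrow> z0 (x, t) = \<zeta> t) \<and> integrable lborel (\<lambda>t. z0 (x, t))"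
  proof (rule ccontr)
    assume *: "\<not> ?thesis"
    have "AE x in lborel. x \<notin> \<omega>"
      using sections lborel_pair.AE_integrable_fst'[OF int0]
      by eventually_elim (use * in blast)
    then have "\<omega> \<in> null_sets lborel" using \<omega>(1) by (simp add: AE_iff_null_sets)
    then have "negligible \<omega>" by (simp add: negligible_iff_null_sets null_sets_completionI)
    then show False using open_not_negligible \<omega> by blast
  qed
  then obtain x0 where x0: "x0 \<in> \<omega>" "AE t in lborel. (x0, t) \<in> cyl \<omega> \<longrightarrow> z0 (x0, t) = \<zeta> t"
    "integrable lborel (\<lambda>t. z0 (x0, t))"
    by blast
  define \<zeta>' where "\<zeta>' t = z0 (x0, t)" for t
  have int': "integrable lborel \<zeta>'" using x0(3) by (simp add: \<zeta>'_def[abs_def])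
  show ?thesis
  proof (rule that[of \<zeta>'])
    show "\<zeta>' \<in> borel_measurable borel" using int' by auto
    show "integrable lborel (\<lambda>t. indicator {0<..<1} t * \<zeta>' t)"
      using integrable_mult_indicator[OF _ int', of "{0<..<1}"] by simp
    have "AE t in lborel. 0 < t \<and> t < 1 \<longrightarrow> \<zeta>' t = \<zeta> t"
      using x0(2) by eventually_elim (use x0(1) in \<open>auto simp: cyl_def \<zeta>'_def\<close>)
    from AE_completion[OF AE_lborel_vertical[OF this]]
    have "AE x in lebesgue_on (cyl \<omega>). 0 < snd x \<and> snd x < 1 \<longrightarrow> \<zeta>' (snd x) = \<zeta> (snd x)"
      by (subst AE_restrict_space_iff) (use c in \<open>auto elim: eventually_mono\<close>)
    with \<zeta> AE_space show "AE x in lebesgue_on (cyl \<omega>). z x = \<zeta>' (snd x)"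
      by eventually_elim (auto simp: cyl_def)
  qed
qed

section \<open>Nondegeneracy\<close>

lemma C1_holder_continuous_deriv:
  assumes "C1_holder \<alpha> f" "0 < \<alpha>"
  shows "continuous_on UNIV (deriv f)"
  unfolding continuous_on_eq_continuous_at[OF open_UNIV]
proof
  fix s :: real
  obtain C where C: "\<And>t u. t \<in> {- (\<bar>s\<bar> + 1)..\<bar>s\<bar> + 1} \<Longrightarrow> u \<in> {- (\<bar>s\<bar> + 1)..\<bar>s\<bar> + 1} \<Longrightarrow>
      \<bar>deriv f t - deriv f u\<bar> \<le> C * \<bar>t - u\<bar> powr \<alpha>"
    using assms(1) unfolding C1_holder_def by meson
  have "((\<lambda>t. C * \<bar>t - s\<bar> powr \<alpha>) \<longlongrightarrow> C * \<bar>s - s\<bar> powr \<alpha>) (at s)"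
    using assms(2) by (intro tendsto_mult tendsto_powr' tendsto_intros) auto
  then have "((\<lambda>t. C * \<bar>t - s\<bar> powr \<alpha>) \<longlongrightarrow> 0) (at s)" using assms(2) by simp
  moreover have "\<forall>\<^sub>F t in at s. norm (deriv f t - deriv f s) \<le> C * \<bar>t - s\<bar> powr \<alpha>"
  proof -
    have "\<forall>\<^sub>F t in at s. dist t s < 1" unfolding eventually_at by (intro exI[of _ 1]) auto
    then show ?thesis
    proof eventually_elim
      case (elim t)
      then have "t \<in> {- (\<bar>s\<bar> + 1)..\<bar>s\<bar> + 1}" "s \<in> {- (\<bar>s\<bar> + 1)..\<bar>s\<bar> + 1}"
        by (auto simp: dist_real_def)
      then show ?case using C by simp
    qed
  qed
  ultimately have "((\<lambda>t. deriv f t - deriv f s) \<longlongrightarrow> 0) (at s)" by (rule Lim_null_comparison[rotated])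
  then show "isCont (deriv f) s" by (simp add: isCont_def LIM_zero_iff)
qed

theorem proposition3p8:
  fixes \<omega> :: "(real ^ 'n) set" and f :: "real \<Rightarrow> real" and \<alpha> :: real
    and u\<^sub>\<omega> :: "(real ^ 'n) \<times> real \<Rightarrow> real"
  assumes "smooth_bounded_domain \<omega>"
    and "0 < \<alpha>" and "\<alpha> < 1" and "C1_holder \<alpha> f"
    and "\<And>s. s \<noteq> 0 \<Longrightarrow> deriv f s > f s / s"
    and "\<And>s. s \<noteq> 0 \<Longrightarrow> s * f s > 0"
    and "\<exists>u. weak_solution f \<omega> u"
    and "one_dim_solution f \<omega> u\<^sub>\<omega>"
    and "\<exists>x\<in>cyl \<omega>. u\<^sub>\<omega> x \<noteq> 0"
  shows "\<not> degenerate_xN f \<omega> u\<^sub>\<omega>"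
proof
  assume "degenerate_xN f \<omega> u\<^sub>\<omega>"
  then obtain z where z: "z \<in> H10_xN \<omega>" and z_ne: "\<not> (AE x in lebesgue_on (cyl \<omega>). z x = 0)"
    and lin: "\<And>v Gz Gv. v \<in> H10_xN \<omega> \<Longrightarrow> has_weak_gradient (cyl \<omega>) z Gz \<Longrightarrow>
      has_weak_gradient (cyl \<omega>) v Gv \<Longrightarrow>
      integral\<^sup>L (lebesgue_on (cyl \<omega>)) (\<lambda>x. Gz x \<bullet> Gv x)
        = integral\<^sup>L (lebesgue_on (cyl \<omega>)) (\<lambda>x. deriv f (u\<^sub>\<omega> x) * z x * v x)"
    unfolding degenerate_xN_def linearized_eigenvalue_def by auto
  have \<omega>: "open \<omega>" "bounded \<omega>" "\<omega> \<noteq> {}"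
    using assms(1) by (auto simp: smooth_bounded_domain_def)
  note S = cyl_open_bounded[OF \<omega>(1,2)]
  have df: "(f has_real_derivative deriv f s) (at s)" for s
    using assms(4) by (simp add: C1_holder_def DERIV_deriv_iff_real_differentiable)
  have cont_df: "continuous_on UNIV (deriv f)"
    using assms(4,2) by (rule C1_holder_continuous_deriv)
  obtain w p where w: "\<And>t. t \<in> {0..1} \<Longrightarrow> (w has_real_derivative p t) (at t within {0..1})"
    and p: "\<And>t. t \<in> {0<..<1} \<Longrightarrow> (p has_real_derivative - f (w t)) (at t)"
    and contp: "continuous_on {0..1} p" and bc: "p 0 = 0" "w 1 = 0"
    and u_eq: "\<And>x. x \<in> cyl \<omega> \<Longrightarrow> u\<^sub>\<omega> x = w (snd x)"
    using assms(8) unfolding one_dim_solution_def one_dim_profile_def by blast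
  have contw: "continuous_on {0..1} w" using w by (rule DERIV_continuous_on)
  have dw: "(w has_real_derivative p t) (at t)" if "0 < t" "t < 1" for t
    using w[of t] that by (simp add: at_within_Icc_at)
  have nontriv: "\<exists>t\<in>{0..1}. w t \<noteq> 0"
  proof -
    obtain x where x: "x \<in> cyl \<omega>" "u\<^sub>\<omega> x \<noteq> 0" using assms(9) by blast
    then have "w (snd x) \<noteq> 0" using u_eq by metis
    then show ?thesis using x(1) by (intro bexI[of _ "snd x"]) (auto simp: cyl_def)
  qed
  \<comment> \<open>The potential is extended from the interval to the line by constants.\<close>
  define q where "q t = deriv f (w (max 0 (min 1 t)))" for t
  have contq: "continuous_on UNIV q"
  proof -
    have "continuous_on UNIV (\<lambda>t :: real. w (max 0 (min 1 t)))"
      by (rule continuous_on_compose2[OF contw]) (auto intro!: continuous_intros)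
    then show ?thesis unfolding q_def by (rule continuous_on_compose2[OF cont_df]) auto
  qed
  have q_eq: "q t = deriv f (w t)" if "0 < t" "t < 1" for t
    using that by (simp add: q_def max_def min_def)
  have z_trace: "has_trace \<omega> z (\<lambda>_. 0)" and "\<exists>\<zeta>. AE x in lebesgue_on (cyl \<omega>). z x = \<zeta> (snd x)"
    using z by (auto simp: H10_xN_def H10_def)
  then obtain \<zeta>0 where \<zeta>0: "AE x in lebesgue_on (cyl \<omega>). z x = \<zeta>0 (snd x)" by blast
  obtain G where G: "has_weak_gradient (cyl \<omega>) z G"
    and parts: "\<And>\<theta> \<theta>'. (\<And>t. (\<theta> has_real_derivative \<theta>' t) (at t)) \<Longrightarrow> continuous_on UNIV \<theta>' \<Longrightarrow> \<theta> 0 = 0 \<Longrightarrow>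
      integral\<^sup>L (lebesgue_on (cyl \<omega>)) (\<lambda>x. G x \<bullet> (0, \<theta> (snd x)))
      = - integral\<^sup>L (lebesgue_on (cyl \<omega>)) (\<lambda>x. z x * \<theta>' (snd x))"
    using zero_trace_integration_by_parts[OF \<omega>(1,2) z_trace] by blast
  have L2z: "L2_on (cyl \<omega>) z" using G by (simp add: has_weak_gradient_def)
  obtain \<zeta> where \<zeta>: "\<zeta> \<in> borel_measurable borel"
    "integrable lborel (\<lambda>t. indicator {0<..<1} t * \<zeta> t)"
    "AE x in lebesgue_on (cyl \<omega>). z x = \<zeta> (snd x)"
    using vertical_representative[OF \<omega> L2z \<zeta>0] by blast
  have m: "measure lebesgue \<omega> \<noteq> 0"
    using open_not_negligible[OF \<omega>(1,3)] negligible_iff_measure0[OF lmeasurable_open[OF \<omega>(2,1)]] by simp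
  \<comment> \<open>Testing the linearized equation with \<open>\<phi>(x\<^sub>N)\<close> and integrating by parts once more moves both
    derivatives to \<open>\<phi>\<close>; the cross section contributes only its measure as a factor.\<close>
  have weak: "integral\<^sup>L lborel (\<lambda>t. indicator {0<..<1} t * (\<zeta> t * (h t + q t * \<phi> t))) = 0"
    if \<phi>: "\<And>t. (\<phi> has_real_derivative \<phi>' t) (at t)" "\<And>t. (\<phi>' has_real_derivative h t) (at t)"
      and h: "continuous_on UNIV h" and bc: "\<phi>' 0 = 0" "\<phi> 1 = 0" for \<phi> \<phi>' h
  proof -
    have cont\<phi>: "continuous_on UNIV \<phi>" using \<phi>(1) by (rule DERIV_everywhere_continuous)
    have cont\<phi>': "continuous_on UNIV \<phi>'" using \<phi>(2) by (rule DERIV_everywhere_continuous)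
    have int: "integrable (lebesgue_on (cyl \<omega>)) (\<lambda>x. z x * k (snd x))" if "continuous_on UNIV k" for k
    proof -
      have ck: "continuous_on UNIV (\<lambda>x :: (real ^ 'n) \<times> real. k (snd x))"
        by (intro continuous_intros continuous_on_compose2[OF that] subset_UNIV)
      obtain B where "\<And>x. x \<in> cyl \<omega> \<Longrightarrow> norm (k (snd x)) \<le> B"
        using bounded_image_continuous[OF ck S(2)] by blast
      from L2_on_integrable_inner[OF S L2z borel_measurable_continuous_onI[OF ck] this]
      show ?thesis by simp
    qed
    note vt = vertical_test_function[OF \<omega>(1,2) \<phi>(1) cont\<phi>' bc(2)]
    have "- integral\<^sup>L (lebesgue_on (cyl \<omega>)) (\<lambda>x. z x * h (snd x))
        = integral\<^sup>L (lebesgue_on (cyl \<omega>)) (\<lambda>x. G x \<bullet> (0, \<phi>' (snd x)))"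
      using parts[OF \<phi>(2) h bc(1)] by simp
    also have "\<dots> = integral\<^sup>L (lebesgue_on (cyl \<omega>)) (\<lambda>x. deriv f (u\<^sub>\<omega> x) * z x * \<phi> (snd x))"
      by (rule lin[OF vt(1) G vt(2)])
    also have "\<dots> = integral\<^sup>L (lebesgue_on (cyl \<omega>)) (\<lambda>x. z x * (q (snd x) * \<phi> (snd x)))"
      by (rule Bochner_Integration.integral_cong) (auto simp: u_eq q_eq cyl_def)
    finally have "integral\<^sup>L (lebesgue_on (cyl \<omega>)) (\<lambda>x. z x * h (snd x))
        + integral\<^sup>L (lebesgue_on (cyl \<omega>)) (\<lambda>x. z x * (q (snd x) * \<phi> (snd x))) = 0" by simp
    then have zero: "integral\<^sup>L (lebesgue_on (cyl \<omega>)) (\<lambda>x. z x * (h (snd x) + q (snd x) * \<phi> (snd x))) = 0"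
      using int[OF h] int[OF continuous_on_mult[OF contq cont\<phi>]] by (simp add: distrib_left)
    define k where "k t = \<zeta> t * (h t + q t * \<phi> t)" for t
    have km: "k \<in> borel_measurable borel"
      unfolding k_def using \<zeta>(1) borel_measurable_continuous_onI[OF h]
        borel_measurable_continuous_onI[OF contq] borel_measurable_continuous_onI[OF cont\<phi>] by measurable
    have "(\<lambda>x :: (real ^ 'n) \<times> real. k (snd x)) \<in> borel_measurable borel"
      using km by (simp add: borel_prod[symmetric])
    then have km': "(\<lambda>x. k (snd x)) \<in> borel_measurable (lebesgue_on (cyl \<omega>))"
      by (rule borel_measurable_lebesgue_on)
    have int': "integrable (lebesgue_on (cyl \<omega>)) (\<lambda>x. z x * (h (snd x) + q (snd x) * \<phi> (snd x)))"
      by (rule int[OF continuous_on_add[OF h continuous_on_mult[OF contq cont\<phi>]]])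
    have ae: "AE x in lebesgue_on (cyl \<omega>). z x * (h (snd x) + q (snd x) * \<phi> (snd x)) = k (snd x)"
      using \<zeta>(3) by eventually_elim (simp add: k_def)
    have intk: "integrable (lebesgue_on (cyl \<omega>)) (\<lambda>x. k (snd x))"
      using ae by (intro Bochner_Integration.integrable_cong_AE_imp[OF int' km']) (auto elim: eventually_mono)
    have "integral\<^sup>L (lebesgue_on (cyl \<omega>)) (\<lambda>x. k (snd x)) = 0"
      using zero integral_cong_AE[OF borel_measurable_integrable[OF int'] km' ae] by simp
    then have "integral\<^sup>L lborel (\<lambda>t. indicator {0<..<1} t * k t) = 0"
      using integral_cyl_vertical[OF \<omega>(1) km intk] m by simp
    then show ?thesis by (simp add: k_def)
  qed
  obtain R y where R: "\<And>t. (R has_real_derivative y t) (at t)"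
    "\<And>t. 0 < t \<Longrightarrow> t < 1 \<Longrightarrow> (y has_real_derivative - (q t * R t)) (at t)"
    "continuous_on UNIV y" "y 0 = 0" "R 1 = 0"
    "AE t in lborel. 0 < t \<and> t < 1 \<longrightarrow> \<zeta> t = R t"
  proof (rule very_weak_solution_regular[OF contq \<zeta>(1,2)])
    fix \<phi> \<phi>' h :: "real \<Rightarrow> real"
    assume a: "\<And>t. (\<phi> has_real_derivative \<phi>' t) (at t)" "\<And>t. (\<phi>' has_real_derivative h t) (at t)"
      "continuous_on UNIV h" "\<phi>' 0 = 0" "\<phi> 1 = 0"
    show "integral\<^sup>L lborel (\<lambda>t. indicator {0<..<1} t * (\<zeta> t * (h t + q t * \<phi> t))) = 0"
      by (rule weak[OF a])
  qed (use that in blast)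
  have R0: "R t = 0" if "t \<in> {0..1}" for t
  proof (rule linearized_ode_trivial[where f = f and f' = "deriv f" and w = w and p = p and z = R and y = y])
    show "(y has_real_derivative - (deriv f (w t) * R t)) (at t)" if "0 < t" "t < 1" for t
      using R(2)[OF that] q_eq[OF that] by simp
    show "continuous_on {0..1} R" using R(1) by (rule DERIV_everywhere_continuous)
    show "continuous_on {0..1} y" using R(3) by (rule continuous_on_subset) simp
  qed (use df cont_df assms(5,6) dw p contw contp bc nontriv R that in auto)
  have "AE t in lborel. 0 < t \<and> t < 1 \<longrightarrow> \<zeta> t = 0"
    using R(6) by eventually_elim (use R0 in auto)
  from AE_completion[OF AE_lborel_vertical[OF this]]
  have "AE x in lebesgue_on (cyl \<omega>). 0 < snd x \<and> snd x < 1 \<longrightarrow> \<zeta> (snd x) = 0"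
    by (subst AE_restrict_space_iff) (use S(1) in \<open>auto simp: borel_open elim: eventually_mono\<close>)
  with \<zeta>(3) AE_space have "AE x in lebesgue_on (cyl \<omega>). z x = 0"
    by eventually_elim (auto simp: cyl_def)
  with z_ne show False by contradiction
qed

end
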